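(* Let $x,y$ be $n\times n$ complex matrices such that none of $x$, $y$, $xy$ has an eigenvalue in $]-\infty,0]$, and such that $\log(xy)=\log(x)+\log(y)$, where $\log$ denotes the principal matrix logarithm. If moreover $x,y$ are simultaneously triangularizable (i.e. there is an invertible complex $n\times n$ matrix $p$ such that $p^{-1}xp$ and $p^{-1}yp$ are both upper triangular), then $xy=yx$.
   Context: For a complex $n\times n$ matrix $x$ with no eigenvalue in the real half-line $]-\infty,0]=\{t\in\mathbb{R}: t\le 0\}$, the principal logarithm $\log(x)$ is the unique complex $n\times n$ matrix $a$ such that $e^a=x$ and every eigenvalue of $a$ lies in the open strip $\{z\in\mathbb{C}: -\pi<\operatorname{Im}(z)<\pi\}$. It exists, and it is a polynomial in $x$. *)

theory Defs
  imports
    "HOL-Library.Nonpos_Ints"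
    "Jordan_Normal_Form.Char_Poly"
begin

(* The exponential series converges absolutely in every entry, so the entrywise
   sum is the sum of the series in the space of matrices. *)
definition mat_exp :: "complex mat \<Rightarrow> complex mat" where
  "mat_exp a = mat (dim_row a) (dim_row a)
     (\<lambda>(i, j). \<Sum>k. (a ^\<^sub>m k) $$ (i, j) / fact k)"

(* Meaningful for square x without an eigenvalue in \<real>\<^sub>\<le>\<^sub>0: exactly then
   the described matrix exists, and it is unique. *)
definition mat_log :: "complex mat \<Rightarrow> complex mat" where
  "mat_log x = (THE a. a \<in> carrier_mat (dim_row x) (dim_row x) \<and> mat_exp a = x \<and>
     (\<forall>z. eigenvalue a z \<longrightarrow> - pi < Im z \<and> Im z < pi))"

definition simultaneously_triangularizable :: "nat \<Rightarrow> complex mat \<Rightarrow> complex mat \<Rightarrow> bool" where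
  "simultaneously_triangularizable n x y \<longleftrightarrow>
     (\<exists>p \<in> carrier_mat n n. \<exists>q \<in> carrier_mat n n.
        inverts_mat p q \<and> inverts_mat q p \<and>
        upper_triangular (q * x * p) \<and> upper_triangular (q * y * p))"

end

theory Submission
  imports Defs "Jordan_Normal_Form.Schur_Decomposition"
begin

text \<open>
  After a change of basis, \<open>x\<close>, \<open>y\<close> and their logarithms \<open>a\<close>, \<open>b\<close> are upper triangular, and
  \<open>exp (a + b) = exp a * exp b\<close>. Suppose \<open>b * a - a * b \<noteq> 0\<close> and let \<open>v\<close> be the leftmost nonzero
  entry, at \<open>(i, j)\<close>, of its last nonzero row. Commuting the equation with \<open>a\<close> and with \<open>b\<close> and
  reading off the \<open>(i, j)\<close> entries shows that \<open>exp\<close> has equal difference quotients on the three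
  points \<open>P = a_ii + b_ii\<close>, \<open>Q = a_ii + b_jj\<close>, \<open>R = a_jj + b_jj\<close>, whose imaginary parts pairwise
  differ by less than \<open>2 * pi\<close>. This forces \<open>P = Q = R\<close>, because for \<open>0 < Im z < 2 * pi\<close> the
  quotient \<open>(exp z - 1) / z\<close> has an argument strictly between \<open>0\<close> and \<open>Im z\<close>. In the remaining
  case the commutator acts centrally as far as the entry \<open>(i, j)\<close> is concerned, and as in the
  Heisenberg group the \<open>(i, j)\<close> entry of \<open>exp (a + b) - exp a * exp b\<close> is \<open>v * exp P / 2 \<noteq> 0\<close>.
\<close>

section \<open>Divided differences of the exponential function\<close>

text \<open>The first divided difference of \<open>exp\<close>. The value on the diagonal is its
  continuous extension, so that coinciding diagonal entries of matrices need no separate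
  treatment.\<close>

definition exp_dd :: "complex \<Rightarrow> complex \<Rightarrow> complex" where
  "exp_dd u v = (if u = v then exp u else (exp u - exp v) / (u - v))"

lemma exp_dd_commute: "exp_dd u v = exp_dd v u"
  by (simp add: exp_dd_def) (metis minus_diff_eq minus_divide_divide)

lemma exp_dd_add: "exp_dd (w + u) (w + v) = exp w * exp_dd u v"
  by (simp add: exp_dd_def exp_add right_diff_distrib)

lemma exp_dd_eq_shift: "exp_dd u v = exp v * exp_dd (u - v) 0"
  using exp_dd_add[of v "u - v" 0] by simp

lemma exp_dd_cnj: "exp_dd (cnj u) (cnj v) = cnj (exp_dd u v)"
  by (simp add: exp_dd_def exp_eq_polar flip: cis_cnj)

section \<open>The argument of \<open>(exp z - 1) / z\<close>\<close>

lemma mult_cos_less_sin: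
  fixes y :: real
  assumes "0 < y" "y \<le> pi"
  shows "y * cos y < sin y"
proof -
  have "(\<lambda>t. sin t - t * cos t) 0 < (\<lambda>t. sin t - t * cos t) y"
  proof (rule DERIV_pos_imp_increasing_open[OF assms(1)])
    fix t assume t: "0 < t" "t < y"
    show "\<exists>d. ((\<lambda>t. sin t - t * cos t) has_real_derivative d) (at t) \<and> 0 < d"
      using t assms by (intro exI[of _ "t * sin t"]) (auto intro!: derivative_eq_intros mult_pos_pos sin_gt_zero)
  qed (auto intro!: continuous_intros)
  then show ?thesis by simp
qed

text \<open>For \<open>z = Complex x y\<close> this says that
  \<open>(exp z - 1) * cnj z * cis (- y)\<close> has negative imaginary part. For nonnegative
  \<open>x\<close> it follows from \<open>1 + x \<le> exp x\<close> and
  \<open>sin y \<le> y\<close>. For negative \<open>x\<close> the delicate case is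
  \<open>0 < cos y\<close>, where \<open>y * cos y < sin y\<close> decides.\<close>

lemma mult_sin_less:
  fixes x y :: real
  assumes y: "0 < y" "y \<le> pi"
  shows "x * sin y < y * (exp x - cos y)"
proof (cases "0 \<le> x")
  case True
  have "cos y < 1" using cos_monotone_0_pi[of 0 y] y by simp
  then have "0 < y * (1 - cos y)" using y by simp
  also have "\<dots> \<le> y * (1 - cos y) + x * (y - sin y)"
    using True sin_x_le_x[of y] y by simp
  also have "\<dots> = y * (1 + x - cos y) - x * sin y" by (simp add: algebra_simps)
  also have "\<dots> \<le> y * (exp x - cos y) - x * sin y"
    using y exp_ge_add_one_self[of x] by (simp add: mult_left_mono)
  finally show ?thesis by simp
next
  case False
  have s: "0 \<le> sin y" using y by (simp add: sin_ge_zero)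
  show ?thesis
  proof (cases "cos y \<le> 0")
    case True
    have "x * sin y \<le> 0" using False s by (simp add: mult_nonpos_nonneg)
    also have "0 < y * (exp x - cos y)"
      using y True exp_gt_zero[of x] by (intro mult_pos_pos) linarith+
    finally show ?thesis .
  next
    case c: False
    have "cos y - exp x \<le> - x * cos y"
    proof (cases "0 \<le> 1 + x")
      case True
      have "(1 + x) * cos y \<le> 1 + x" using True by (simp add: mult_left_le)
      then have "(1 + x) * cos y \<le> exp x" using exp_ge_add_one_self[of x] by linarith
      then show ?thesis by (simp add: algebra_simps)
    next
      case False
      have "1 * cos y \<le> (- x) * cos y" using False c by (intro mult_right_mono) auto
      then show ?thesis using exp_gt_zero[of x] by linarith
    qed
    then have "y * (cos y - exp x) \<le> y * (- x * cos y)" using y by (intro mult_left_mono) auto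
    also have "\<dots> = (- x) * (y * cos y)" by simp
    also have "\<dots> < (- x) * sin y"
      using False mult_cos_less_sin[OF y] by (intro mult_strict_left_mono) auto
    finally show ?thesis by (simp add: algebra_simps)
  qed
qed

text \<open>Writing \<open>z = 2 h\<close>, the number \<open>q\<close> below is a positive multiple of \<open>sinh h / h\<close>, and the claim
  is that its argument has absolute value less than \<open>k = Im h\<close>.\<close>

lemma exp_dd_sector:
  assumes "0 < Im z" "Im z < 2 * pi"
  shows "\<exists>r \<eta>. 0 < r \<and> 0 < \<eta> \<and> \<eta> < Im z \<and> exp_dd z 0 = rcis r \<eta>"
proof -
  define x y k where "x = Re z" and "y = Im z" and "k = Im z / 2"
  have y: "0 < y" "y < 2 * pi" and k: "0 < k" "k < pi" "y = 2 * k"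
    using assms by (auto simp: y_def k_def)
  have z: "z = Complex x y" by (simp add: x_def y_def)
  have z0: "z \<noteq> 0" using y by (auto simp: y_def)
  define q where "q = exp_dd z 0 * cis (- k)"
  define N where "N = (cmod z)\<^sup>2"
  have N: "0 < N" using z0 by (simp add: N_def)
  have dd: "exp_dd z 0 = (exp z - 1) * cnj z / of_real N"
  proof -
    have "z * cnj z = of_real N" unfolding N_def by (simp only: complex_norm_square)
    then show ?thesis using z0 by (simp add: exp_dd_def divide_simps flip: \<open>z * cnj z = of_real N\<close>)
  qed
  \<comment> \<open>One formula for all rotations needed: \<open>t = - y\<close> gives
    \<open>A\<close>, \<open>t = 0\<close> gives \<open>B\<close> and \<open>t = - k\<close> gives
    \<open>C\<close>.\<close>
  have Im_rot: "Im (exp_dd z 0 * cis t) * N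
      = x * (exp x * sin (y + t) - sin t) - y * (exp x * cos (y + t) - cos t)" for t
  proof -
    have e: "exp z = of_real (exp x) * cis y" by (simp add: z exp_eq_polar)
    have "exp_dd z 0 * cis t = (of_real (exp x) * cis (y + t) - cis t) * cnj z / of_real N"
      by (simp add: dd e cis_mult[symmetric] algebra_simps)
    then have "Im (exp_dd z 0 * cis t) = Im ((of_real (exp x) * cis (y + t) - cis t) * cnj z) / N"
      by (simp only: Im_divide_of_real)
    then have "Im (exp_dd z 0 * cis t) * N = Im ((of_real (exp x) * cis (y + t) - cis t) * cnj z)"
      using N by simp
    then show ?thesis by (simp add: x_def y_def algebra_simps)
  qed
  have A: "Im (q * cis (- k)) < 0" if "x * sin y < y * (exp x - cos y)"
  proof -
    have "Im (exp_dd z 0 * cis (- y)) * N < 0"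
      unfolding Im_rot using that by (simp add: algebra_simps)
    then show ?thesis using N by (simp add: q_def k(3) cis_mult mult.assoc mult_less_0_iff)
  qed
  have B: "Im (q * cis k) > 0" if "- x * sin y < y * (exp (- x) - cos y)"
  proof -
    have "exp x * (- x * sin y) < exp x * (y * (exp (- x) - cos y))"
      using that by (intro mult_strict_left_mono) auto
    also have "\<dots> = y * (1 - exp x * cos y)" by (simp add: algebra_simps exp_minus)
    finally have "Im (exp_dd z 0 * cis 0) * N > 0"
      unfolding Im_rot by (simp add: algebra_simps)
    then show ?thesis using N by (simp add: q_def cis_mult mult.assoc zero_less_mult_iff)
  qed
  have C: "Im q * N = x * sin k * (exp x + 1) - y * cos k * (exp x - 1)"
    unfolding q_def Im_rot by (simp add: k(3) algebra_simps)
  define \<theta> where "\<theta> = Arg q"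
  have th: "- pi < \<theta>" "\<theta> \<le> pi" using Arg_bounded[of q] by (auto simp: \<theta>_def)
  have q: "q = rcis (cmod q) \<theta>" by (simp add: \<theta>_def rcis_cmod_Arg)
  have Imq: "Im (q * cis t) = cmod q * sin (\<theta> + t)" for t
    by (subst q) (simp add: cis_rcis_eq rcis_mult)
  \<comment> \<open>If the bound failed, \<open>\<theta> - k\<close> would lie between
    \<open>0\<close> and \<open>pi\<close>, where the sine is nonnegative. \<open>B'\<close> is the
    mirror image.\<close>
  have A': "\<theta> < k" if "Im (q * cis (- k)) < 0"
  proof (rule ccontr)
    assume "\<not> \<theta> < k"
    then have "0 \<le> sin (\<theta> - k)" using th k by (intro sin_ge_zero) auto
    then have "0 \<le> cmod q * sin (\<theta> + (- k))" by simp
    then show False using that unfolding Imq by linarith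
  qed
  have B': "- k < \<theta>" if "Im (q * cis k) > 0"
  proof (rule ccontr)
    assume "\<not> - k < \<theta>"
    then have "0 \<le> sin (- (\<theta> + k))" using th k by (intro sin_ge_zero) auto
    then have "sin (\<theta> + k) \<le> 0" unfolding sin_minus by simp
    then have "cmod q * sin (\<theta> + k) \<le> 0" by (simp add: mult_nonneg_nonpos)
    then show False using that unfolding Imq by linarith
  qed
  have *: "\<theta> < k \<and> - k < \<theta> \<and> q \<noteq> 0"
  proof (cases "y \<le> pi")
    case True
    then have "Im (q * cis (- k)) < 0" "Im (q * cis k) > 0"
      using A B mult_sin_less[of y x] mult_sin_less[of y "- x"] y by auto
    then show ?thesis using A' B' by auto
  next
    case False
    have sy: "sin y < 0" using False y sin_gt_zero[of "y - pi"] by simp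
    have cy: "cos y < 1" using False y cos_monotone_0_pi[of 0 "2 * pi - y"] by (simp add: cos_2pi_minus)
    have sk: "sin k > 0" using k by (simp add: sin_gt_zero)
    have ck: "cos k < 0" using k False cos_monotone_0_pi[of "pi/2" k] by simp
    show ?thesis
    proof (cases "0 \<le> x")
      case True
      have "x * sin y \<le> 0" using True sy by (simp add: mult_nonneg_nonpos)
      also have "0 < y * (exp x - cos y)" using y cy True one_le_exp_iff[of x] by (intro mult_pos_pos) linarith+
      finally have a: "Im (q * cis (- k)) < 0" by (rule A)
      have "0 \<le> x * sin k * (exp x + 1)" using True sk by simp
      moreover have "y * cos k * (exp x - 1) \<le> 0"
        using True ck y by (intro mult_nonpos_nonneg mult_nonneg_nonpos) auto
      ultimately have "0 \<le> Im q * N" unfolding C by linarith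
      then have "0 \<le> Im q" using N by (simp add: zero_le_mult_iff)
      have "\<theta> \<ge> 0"
      proof (rule ccontr)
        assume "\<not> \<theta> \<ge> 0"
        then have "0 < sin (- \<theta>)" using th by (intro sin_gt_zero) auto
        moreover have "q \<noteq> 0" using a by auto
        ultimately have "cmod q * sin (\<theta> + 0) < 0" by (simp add: mult_pos_neg)
        then show False using \<open>0 \<le> Im q\<close> Imq[of 0] by simp
      qed
      then show ?thesis using A'[OF a] a k by auto
    next
      case x: False
      have "- x * sin y \<le> 0" using x sy by (simp add: mult_nonneg_nonpos mult_nonpos_nonpos)
      also have "0 < y * (exp (- x) - cos y)" using y cy x one_le_exp_iff[of "- x"] by (intro mult_pos_pos) linarith+
      finally have b: "Im (q * cis k) > 0" by (rule B)
      have "x * sin k * (exp x + 1) \<le> 0" using x sk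
        by (intro mult_nonpos_nonneg) auto
      moreover have "0 \<le> y * cos k * (exp x - 1)"
        using x ck y by (intro mult_nonpos_nonpos mult_nonneg_nonpos) auto
      ultimately have "Im q * N \<le> 0" unfolding C by linarith
      then have "Im q \<le> 0" using N by (simp add: mult_le_0_iff)
      have "\<theta> < k"
      proof (rule ccontr)
        assume t: "\<not> \<theta> < k"
        have q0: "0 < cmod q" using b by auto
        show False
        proof (cases "\<theta> = pi")
          \<comment> \<open>The condition \<open>Im q \<le> 0\<close> alone permits the angle
            \<open>pi\<close>, since the range of \<open>Arg\<close> includes this end. Rotation by
            \<open>k\<close> rules it out.\<close>
          case True
          then have "cmod q * sin (\<theta> + k) < 0" using sk q0 by (simp add: mult_pos_neg)
          then show False using b Imq[of k] by simp
        next
          case False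
          then have "0 < sin \<theta>" using th t k by (intro sin_gt_zero) auto
          then have "0 < cmod q * sin (\<theta> + 0)" using q0 by simp
          then show False using \<open>Im q \<le> 0\<close> Imq[of 0] by simp
        qed
      qed
      then show ?thesis using B'[OF b] b by auto
    qed
  qed
  have "exp_dd z 0 = q * cis k" by (simp add: q_def cis_mult mult.assoc)
  also have "\<dots> = rcis (cmod q) (\<theta> + k)" by (subst q) (simp add: cis_rcis_eq rcis_mult)
  finally show ?thesis
    using * k by (intro exI[of _ "cmod q"] exI[of _ "\<theta> + k"]) (auto simp: y_def)
qed

section \<open>Points at which divided differences agree\<close>

lemma exp_dd_of_real: "exp_dd (of_real x) 0 = of_real (if x = 0 then 1 else (exp x - 1) / x)"
  by (simp add: exp_dd_def flip: exp_of_real)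

text \<open>Strictness comes from squaring the weak bound at \<open>t / 2\<close>, which leaves a
  surplus of \<open>t^2 / 4\<close>.\<close>

lemma exp_gt_add_one_self:
  fixes t :: real
  assumes "t \<noteq> 0"
  shows "1 + t < exp t"
proof (cases "0 \<le> 1 + t / 2")
  case True
  have "1 + t < 1 + t + t\<^sup>2 / 4" using assms by simp
  also have "\<dots> = (1 + t / 2) * (1 + t / 2)" by (simp add: power2_eq_square algebra_simps)
  also have "\<dots> \<le> exp (t / 2) * exp (t / 2)"
    using True exp_ge_add_one_self[of "t / 2"] by (intro mult_mono) auto
  also have "\<dots> = exp t" by (simp flip: exp_add)
  finally show ?thesis .
next
  case False
  then show ?thesis using exp_gt_zero[of t] by linarith
qed

text \<open>Strict convexity with denominators cleared: both secants are compared with the tangent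
  at \<open>b\<close>, whose slope is \<open>exp b\<close>.\<close>

lemma exp_real_slope_less:
  fixes a b c :: real
  assumes "a < b" "b < c"
  shows "(exp b - exp a) * (c - b) < (exp c - exp b) * (b - a)"
proof -
  have *: "exp b * (t - b) < exp t - exp b" if "t \<noteq> b" for t
  proof -
    have "1 + (t - b) < exp (t - b)" using that by (intro exp_gt_add_one_self) auto
    then have "exp b * (1 + (t - b)) < exp b * exp (t - b)" by simp
    then show ?thesis by (simp add: algebra_simps exp_diff)
  qed
  have "(exp b - exp a) * (c - b) < (exp b * (b - a)) * (c - b)"
    using *[of a] assms by (intro mult_strict_right_mono) (auto simp: algebra_simps)
  also have "\<dots> = (exp b * (c - b)) * (b - a)" by simp
  also have "\<dots> < (exp c - exp b) * (b - a)"
    using *[of c] assms by (intro mult_strict_right_mono) auto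
  finally show ?thesis .
qed

text \<open>The quotient is the slope of a secant through the point over \<open>0\<close>, hence
  strictly increasing by strict convexity. The cases record where \<open>0\<close> lies relative to
  the two points.\<close>

lemma exp_dd_real_inj:
  fixes x x' :: real
  assumes "exp_dd (of_real x) 0 = exp_dd (of_real x') 0"
  shows "x = x'"
proof -
  define g where "g x = (if x = 0 then 1 else (exp x - 1) / x)" for x :: real
  have less: "g s < g t" if "s < t" for s t
  proof -
    consider "s = 0" | "t = 0" | "0 < s" | "t < 0" | "s < 0" "0 < t" by linarith
    then show ?thesis
    proof cases
      case 1
      then show ?thesis using that exp_gt_add_one_self[of t] by (simp add: g_def field_simps)
    next
      case 2
      then show ?thesis using that exp_gt_add_one_self[of s] by (simp add: g_def field_simps)
    next
      case 3
      then show ?thesis using that exp_real_slope_less[of 0 s t]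
        by (simp add: g_def field_simps)
    next
      case 4
      then show ?thesis using that exp_real_slope_less[of s t 0]
        by (simp add: g_def field_simps)
    next
      case 5
      then show ?thesis using that exp_real_slope_less[of s 0 t]
        by (simp add: g_def field_simps)
    qed
  qed
  have "g x = g x'"
    using assms by (simp only: exp_dd_of_real of_real_eq_iff g_def)
  then show ?thesis using less[of x x'] less[of x' x] by linarith
qed

text \<open>The sector statement extended to real \<open>z\<close>, where the angle is
  \<open>0\<close>. The implication keeps the part of strictness that is needed later: only real
  \<open>z\<close> have angle \<open>0\<close>.\<close>

lemma exp_dd_polar:
  assumes "0 \<le> Im z" "Im z < 2 * pi"
  shows "\<exists>r \<eta>. 0 < r \<and> 0 \<le> \<eta> \<and> \<eta> \<le> Im z \<and> (\<eta> = 0 \<longrightarrow> Im z = 0) \<and> exp_dd z 0 = rcis r \<eta>"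
proof (cases "Im z = 0")
  case True
  define r where "r = (if Re z = 0 then 1 else (exp (Re z) - 1) / Re z)"
  have z: "z = of_real (Re z)" using True by (simp add: complex_eq_iff)
  have "exp_dd z 0 = rcis r 0" by (subst z) (simp add: exp_dd_of_real r_def)
  moreover have "0 < r" by (auto simp: r_def divide_pos_pos divide_neg_neg zero_less_divide_iff)
  ultimately show ?thesis using True by (intro exI[of _ r] exI[of _ 0]) simp
next
  case False
  then have "0 < Im z" using assms by simp
  from exp_dd_sector[OF this assms(2)] obtain r \<eta>
    where "0 < r" "0 < \<eta>" "\<eta> < Im z" "exp_dd z 0 = rcis r \<eta>" by auto
  then show ?thesis by (intro exI[of _ r] exI[of _ \<eta>]) simp
qed

text \<open>The zeros of \<open>(exp z - 1) / z\<close> are the nonzero multiples of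
  \<open>2 * pi * i\<close>, just outside the strip. This makes the principal logarithm both unique
  and constructible. Conjugation covers negative imaginary parts.\<close>

lemma exp_dd_nonzero:
  assumes "\<bar>Im (u - v)\<bar> < 2 * pi"
  shows "exp_dd u v \<noteq> 0"
proof -
  have "exp_dd z 0 \<noteq> 0" if "0 \<le> Im z" "Im z < 2 * pi" for z
    using exp_dd_polar[OF that] by auto
  from this[of "u - v"] this[of "cnj (u - v)"] assms
  have "exp_dd (u - v) 0 \<noteq> 0"
    using exp_dd_cnj[of "u - v" 0] by (cases "0 \<le> Im (u - v)") auto
  then show ?thesis by (simp add: exp_dd_eq_shift[of u v])
qed

text \<open>By the sector lemma the arguments of the two sides differ by less than \<open>2 * pi\<close>, so they
  can only agree if both points are real.\<close>

lemma exp_dd_eq_imp_eq: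
  assumes "Im v \<le> 0" "0 \<le> Im u" "Im u - Im v < 2 * pi"
    and eq: "exp_dd u 0 = exp_dd v 0"
  shows "u = v"
proof -
  obtain r \<eta> where u: "0 < r" "0 \<le> \<eta>" "\<eta> \<le> Im u" "\<eta> = 0 \<Longrightarrow> Im u = 0" "exp_dd u 0 = rcis r \<eta>"
    using assms exp_dd_polar[of u] by auto
  obtain s \<zeta> where v: "0 < s" "0 \<le> \<zeta>" "\<zeta> \<le> - Im v" "\<zeta> = 0 \<Longrightarrow> Im v = 0" "exp_dd (cnj v) 0 = rcis s \<zeta>"
    using assms exp_dd_polar[of "cnj v"] by auto
  have "rcis r \<eta> = cnj (rcis s \<zeta>)"
    using exp_dd_cnj[of "v" 0] u(5) v(5) eq by simp
  \<comment> \<open>The two angles have opposite orientation, so rotating by \<open>\<zeta>\<close>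
    adds them up and must produce the positive real number \<open>s\<close>.\<close>
  then have "rcis r \<eta> * cis \<zeta> = cnj (rcis s \<zeta>) * cis \<zeta>" by simp
  then have "rcis r (\<eta> + \<zeta>) = of_real s"
    by (simp add: rcis_def cis_cnj cis_mult mult.assoc)
  then have *: "r * cos (\<eta> + \<zeta>) = s" "r * sin (\<eta> + \<zeta>) = 0"
    by (auto simp: complex_eq_iff)
  have "\<eta> + \<zeta> = 0"
  proof (rule ccontr)
    assume "\<eta> + \<zeta> \<noteq> 0"
    then have pos: "0 < \<eta> + \<zeta>" "\<eta> + \<zeta> < 2 * pi" using u v assms by auto
    have "sin (\<eta> + \<zeta>) = 0" using * u by simp
    then have "\<eta> + \<zeta> = pi"
      using pos sin_gt_zero[of "\<eta> + \<zeta>"] sin_lt_zero[of "\<eta> + \<zeta>"] by fastforce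
    \<comment> \<open>At \<open>pi\<close> the cosine is \<open>- 1\<close>, which is incompatible
      with \<open>r\<close> and \<open>s\<close> both being positive.\<close>
    then show False using * u v by auto
  qed
  then have "Im u = 0" "Im v = 0" using u v by auto
  then have r: "u = of_real (Re u)" "v = of_real (Re v)" by (auto simp: complex_eq_iff)
  show ?thesis using exp_dd_real_inj[of "Re u" "Re v"] eq r by metis
qed

text \<open>Apply the previous lemma based at the point whose imaginary part is the middle one.\<close>

lemma exp_dd_three_points:
  assumes "\<bar>Im (P - Q)\<bar> < 2 * pi" "\<bar>Im (P - R)\<bar> < 2 * pi" "\<bar>Im (Q - R)\<bar> < 2 * pi"
    and "exp_dd P Q = exp_dd P R" "exp_dd P R = exp_dd Q R"
  shows "P = Q \<and> Q = R"
proof -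
  have key: "X = M \<and> Y = M"
    if "Im Y \<le> Im M" "Im M \<le> Im X" "Im X - Im Y < 2 * pi"
      "exp_dd X M = exp_dd Y M" "exp_dd X Y = exp_dd X M" for X Y M
  proof -
    have "exp M * exp_dd (X - M) 0 = exp M * exp_dd (Y - M) 0"
      using that(4) by (simp only: flip: exp_dd_eq_shift)
    then have "exp_dd (X - M) 0 = exp_dd (Y - M) 0" by simp
    from exp_dd_eq_imp_eq[OF _ _ _ this] have "X - M = Y - M" using that(1-3) by simp
    then have XY: "X = Y" by simp
    \<comment> \<open>All three imaginary parts now coincide, so the same lemma applies again, based
      at \<open>X\<close> and with \<open>0\<close> as one of its points.\<close>
    have "exp X * exp_dd (X - X) 0 = exp X * exp_dd (M - X) 0"
      using that(5) XY exp_dd_commute[of X M] by (simp only: flip: exp_dd_eq_shift)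
    then have "exp_dd 0 0 = exp_dd (M - X) 0" by simp
    from exp_dd_eq_imp_eq[OF _ _ _ this] have "0 = M - X" using that(1-3) XY by simp
    then show ?thesis using XY by simp
  qed
  have eqs: "exp_dd P Q = exp_dd Q R" "exp_dd Q P = exp_dd Q R" "exp_dd P R = exp_dd Q R"
    "exp_dd R P = exp_dd Q R" "exp_dd R Q = exp_dd Q R"
    using assms(4,5) exp_dd_commute by metis+
  consider "Im P \<le> Im Q" "Im Q \<le> Im R" | "Im P \<le> Im R" "Im R \<le> Im Q" | "Im Q \<le> Im P" "Im P \<le> Im R"
    | "Im Q \<le> Im R" "Im R \<le> Im P" | "Im R \<le> Im P" "Im P \<le> Im Q" | "Im R \<le> Im Q" "Im Q \<le> Im P"
    by linarith
  then show ?thesis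
  proof cases
    case 1 then show ?thesis using key[of P Q R] assms(1-3) unfolding eqs by simp
  next
    case 2 then show ?thesis using key[of P R Q] assms(1-3) unfolding eqs by simp
  next
    case 3 then show ?thesis using key[of Q P R] assms(1-3) unfolding eqs by simp
  next
    case 4 then show ?thesis using key[of Q R P] assms(1-3) unfolding eqs by simp
  next
    case 5 then show ?thesis using key[of R P Q] assms(1-3) unfolding eqs by simp
  next
    case 6 then show ?thesis using key[of R Q P] assms(1-3) unfolding eqs by simp
  qed
qed

section \<open>Matrix exponentials and corner entries\<close>

text \<open>The matrix laws carry dimension premises. With every dimension fixed to one
  \<open>n\<close>, the simplifier can discharge them.\<close>

lemmas square_mat_simps =
  assoc_mult_mat[of _ n n _ n _ n]
  add_mult_distrib_mat[of _ n n _ _ n] mult_add_distrib_mat[of _ n n _ n]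
  minus_mult_distrib_mat[of _ n n _ _ n] mult_minus_distrib_mat[of _ n n _ n]
  mult_carrier_mat[of _ n n _ n] minus_carrier_mat[of _ n n] pow_carrier_mat[of _ n] for n

text \<open>Used in place of the expansion into scalar products of rows and columns, which is
  removed from the simplifier afterwards so that products stay intact until their entries are
  wanted.\<close>

lemma mult_mat_entry:
  assumes "A \<in> carrier_mat nr n" "B \<in> carrier_mat n nc" "i < nr" "j < nc"
  shows "(A * B) $$ (i, j) = (\<Sum>l<n. A $$ (i, l) * B $$ (l, j))"
  using assms by (simp add: scalar_prod_def atLeast0LessThan)

declare index_mult_mat(1)[simp del]

lemma norm_pow_mat_entry_le:
  fixes a :: "complex mat"
  assumes a: "a \<in> carrier_mat n n" and "i < n" "j < n"
  shows "norm ((a ^\<^sub>m k) $$ (i, j)) \<le> (\<Sum>l<n. \<Sum>m<n. norm (a $$ (l, m))) ^ k"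
  using assms(3)
proof (induction k arbitrary: j)
  case 0
  then show ?case using assms by simp
next
  case (Suc k)
  let ?K = "\<Sum>l<n. \<Sum>m<n. norm (a $$ (l, m))"
  have K: "0 \<le> ?K" by (intro sum_nonneg) auto
  have "norm ((a ^\<^sub>m Suc k) $$ (i, j)) = norm (\<Sum>l<n. (a ^\<^sub>m k) $$ (i, l) * a $$ (l, j))"
    using a \<open>i < n\<close> Suc.prems by (simp add: mult_mat_entry[of _ n n _ n] pow_carrier_mat)
  also have "\<dots> \<le> (\<Sum>l<n. ?K ^ k * norm (a $$ (l, j)))"
    by (rule sum_norm_le) (auto simp: norm_mult intro!: mult_right_mono Suc.IH)
  also have "\<dots> = ?K ^ k * (\<Sum>l<n. norm (a $$ (l, j)))" by (simp add: sum_distrib_left)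
  also have "\<dots> \<le> ?K ^ k * ?K"
    using K Suc.prems by (intro mult_left_mono sum_mono member_le_sum) auto
  finally show ?case by (simp add: mult.commute)
qed

lemma dim_mat_exp [simp]: "dim_row (mat_exp a) = dim_row a" "dim_col (mat_exp a) = dim_row a"
  by (simp_all add: mat_exp_def)

lemma mat_exp_carrier [simp]: "a \<in> carrier_mat n n \<Longrightarrow> mat_exp a \<in> carrier_mat n n"
  by (simp add: mat_exp_def)

text \<open>Comparison with a real exponential series. Absolute convergence is recorded because a
  Cauchy product of two such series is formed later.\<close>

lemma mat_exp_summable_norm:
  fixes a :: "complex mat"
  assumes a: "a \<in> carrier_mat n n" and ij: "i < n" "j < n"
  shows "summable (\<lambda>k. norm ((a ^\<^sub>m k) $$ (i, j) / fact k))"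
proof (rule summable_comparison_test)
  let ?K = "\<Sum>l<n. \<Sum>m<n. norm (a $$ (l, m))"
  show "summable (\<lambda>k. ?K ^ k / fact k)" using summable_exp[of ?K] by (simp add: field_simps)
  show "\<exists>N. \<forall>k\<ge>N. norm (norm ((a ^\<^sub>m k) $$ (i, j) / fact k)) \<le> ?K ^ k / fact k"
    using norm_pow_mat_entry_le[OF a] ij by (auto simp: norm_divide divide_right_mono)
qed

lemma mat_exp_sums:
  assumes a: "a \<in> carrier_mat n n" and ij: "i < n" "j < n"
  shows "(\<lambda>k. (a ^\<^sub>m k) $$ (i, j) / fact k) sums (mat_exp a $$ (i, j))"
  using summable_norm_cancel[OF mat_exp_summable_norm[OF assms]] a ij
  by (simp add: mat_exp_def summable_sums)

lemma mult_mat_exp_sums: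
  assumes a: "a \<in> carrier_mat n n" and p: "p \<in> carrier_mat n n" and ij: "i < n" "j < n"
  shows "(\<lambda>k. (p * a ^\<^sub>m k) $$ (i, j) / fact k) sums ((p * mat_exp a) $$ (i, j))"
proof -
  have "(\<lambda>k. \<Sum>l<n. p $$ (i, l) * ((a ^\<^sub>m k) $$ (l, j) / fact k)) sums
      (\<Sum>l<n. p $$ (i, l) * mat_exp a $$ (l, j))"
    using ij by (intro sums_sum sums_mult mat_exp_sums[OF a]) auto
  then show ?thesis
    using a p ij by (simp add: mult_mat_entry[of _ n n _ n] pow_carrier_mat sum_divide_distrib)
qed

lemma mat_exp_mult_sums:
  assumes a: "a \<in> carrier_mat n n" and q: "q \<in> carrier_mat n n" and ij: "i < n" "j < n"
  shows "(\<lambda>k. (a ^\<^sub>m k * q) $$ (i, j) / fact k) sums ((mat_exp a * q) $$ (i, j))"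
proof -
  have "(\<lambda>k. \<Sum>l<n. ((a ^\<^sub>m k) $$ (i, l) / fact k) * q $$ (l, j)) sums
      (\<Sum>l<n. mat_exp a $$ (i, l) * q $$ (l, j))"
    using ij by (intro sums_sum sums_mult2 mat_exp_sums[OF a]) auto
  then show ?thesis
    using a q ij by (simp add: mult_mat_entry[of _ n n _ n] pow_carrier_mat sum_divide_distrib)
qed

text \<open>The relation passes to powers and then to the series. Admitting two different matrices
  covers change of basis as well as commutation.\<close>

lemma mat_exp_intertwine:
  assumes "a \<in> carrier_mat n n" "b \<in> carrier_mat n n" "m \<in> carrier_mat n n"
    and eq: "a * m = m * b"
  shows "mat_exp a * m = m * mat_exp b"
proof (rule eq_matI)
  have pow: "a ^\<^sub>m k * m = m * b ^\<^sub>m k" for k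
  proof (induction k)
    case (Suc k)
    have "a ^\<^sub>m Suc k * m = a ^\<^sub>m k * m * b"
      using assms by (simp add: square_mat_simps[where n = n])
    then show ?case using Suc assms by (simp add: square_mat_simps[where n = n])
  qed (use assms in simp)
  fix i j assume "i < dim_row (m * mat_exp b)" "j < dim_col (m * mat_exp b)"
  then have ij: "i < n" "j < n" using assms mat_exp_carrier[OF assms(2)] by auto
  show "(mat_exp a * m) $$ (i, j) = (m * mat_exp b) $$ (i, j)"
    using mat_exp_mult_sums[OF assms(1,3) ij] mult_mat_exp_sums[OF assms(2,3) ij]
    unfolding pow by (rule sums_unique2)
qed (use assms mat_exp_carrier[OF assms(1)] mat_exp_carrier[OF assms(2)] in auto)

lemma mat_exp_similar:
  assumes sim: "similar_mat_wit x a p q"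
  shows "similar_mat_wit (mat_exp x) (mat_exp a) p q"
proof -
  define n where "n = dim_row x"
  note s = similar_mat_witD[OF n_def sim]
  have "x * p = p * a" using s by (simp add: square_mat_simps[where n = n])
  then have "mat_exp x * p = p * mat_exp a" using s by (intro mat_exp_intertwine) auto
  then have "mat_exp x * p * q = p * mat_exp a * q" by simp
  moreover have "mat_exp x * p * q = mat_exp x"
    using s(1,4,6,7) mat_exp_carrier[OF s(4)] by (simp only: square_mat_simps[where n = n] right_mult_one_mat)
  ultimately have "mat_exp x = p * mat_exp a * q" by simp
  then show ?thesis using s by (intro similar_mat_witI[of _ _ n]) auto
qed

section \<open>Corner entries and triangular matrices\<close>

text \<open>\<open>m\<close> vanishes weakly below and to the left of position \<open>(i, j)\<close>, except at \<open>(i, j)\<close> itself. For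
  upper triangular factors on either side, such a corner entry only feels their diagonal entries.\<close>

definition corner :: "nat \<Rightarrow> nat \<Rightarrow> nat \<Rightarrow> complex mat \<Rightarrow> complex \<Rightarrow> bool" where
  "corner n i j m v \<longleftrightarrow> m \<in> carrier_mat n n \<and> i < n \<and> j < n \<and> m $$ (i, j) = v \<and>
     (\<forall>k l. i \<le> k \<and> k < n \<and> l \<le> j \<and> (k, l) \<noteq> (i, j) \<longrightarrow> m $$ (k, l) = 0)"

lemma cornerD:
  assumes "corner n i j m v"
  shows "m \<in> carrier_mat n n" "i < n" "j < n" "m $$ (i, j) = v"
  using assms by (auto simp: corner_def)

lemma corner_add: "corner n i j m v \<Longrightarrow> corner n i j m' v' \<Longrightarrow> corner n i j (m + m') (v + v')"
  by (auto simp: corner_def)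

lemma corner_minus: "corner n i j m v \<Longrightarrow> corner n i j m' v' \<Longrightarrow> corner n i j (m - m') (v - v')"
  by (auto simp: corner_def minus_carrier_mat)

lemma corner_zero: "i < n \<Longrightarrow> j < n \<Longrightarrow> corner n i j (0\<^sub>m n n) 0"
  by (auto simp: corner_def)

text \<open>In the sum for entry \<open>(k, l)\<close>, terms with \<open>t < k\<close> vanish
  because \<open>A\<close> is triangular, and terms with \<open>t \<ge> k\<close> vanish because
  \<open>m\<close> does, except for \<open>t = k = i\<close> and \<open>l = j\<close>.\<close>

lemma corner_mult_left:
  assumes A: "A \<in> carrier_mat n n" "upper_triangular A" and m: "corner n i j m v"
  shows "corner n i j (A * m) (A $$ (i, i) * v)"
proof -
  note mD = cornerD[OF m]
  have zero: "A $$ (k, t) * m $$ (t, l) = 0"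
    if "i \<le> k" "k < n" "l \<le> j" "t < n" "(k, l, t) \<noteq> (i, j, i)" for k l t
  proof (cases "t < k")
    case True
    then show ?thesis using upper_triangularD[OF A(2), of t k] A that by simp
  next
    case False
    then show ?thesis using m that unfolding corner_def by auto
  qed
  have "(A * m) $$ (i, j) = (\<Sum>t<n. A $$ (i, t) * m $$ (t, j))"
    using A mD by (simp add: mult_mat_entry[of _ n n _ n])
  also have "\<dots> = (\<Sum>t\<in>{i}. A $$ (i, t) * m $$ (t, j))"
    using mD by (intro sum.mono_neutral_right) (auto simp: zero)
  finally show ?thesis
    using A mD unfolding corner_def
    by (auto simp: mult_mat_entry[of _ n n _ n] zero intro!: sum.neutral)
qed

lemma corner_mult_right:
  assumes B: "B \<in> carrier_mat n n" "upper_triangular B" and m: "corner n i j m v"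
  shows "corner n i j (m * B) (v * B $$ (j, j))"
proof -
  note mD = cornerD[OF m]
  have zero: "m $$ (k, t) * B $$ (t, l) = 0"
    if "i \<le> k" "k < n" "l \<le> j" "t < n" "(k, l, t) \<noteq> (i, j, j)" for k l t
  proof (cases "l < t")
    case True
    then show ?thesis using upper_triangularD[OF B(2), of l t] B that by simp
  next
    case False
    then show ?thesis using m that unfolding corner_def by auto
  qed
  have "(m * B) $$ (i, j) = (\<Sum>t<n. m $$ (i, t) * B $$ (t, j))"
    using B mD by (simp add: mult_mat_entry[of _ n n _ n])
  also have "\<dots> = (\<Sum>t\<in>{j}. m $$ (i, t) * B $$ (t, j))"
    using mD by (intro sum.mono_neutral_right) (auto simp: zero)
  finally show ?thesis
    using B mD unfolding corner_def
    by (auto simp: mult_mat_entry[of _ n n _ n] zero intro!: sum.neutral)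
qed

lemma corner_sums:
  assumes F: "\<And>t. corner n i j (F t) (f t)" and M: "M \<in> carrier_mat n n"
    and sums: "\<And>k l. k < n \<Longrightarrow> l < n \<Longrightarrow> (\<lambda>t. F t $$ (k, l) / fact t) sums (M $$ (k, l))"
    and f: "(\<lambda>t. f t / fact t) sums v"
  shows "corner n i j M v"
proof -
  have ij: "i < n" "j < n" using cornerD[OF F] by auto
  have "M $$ (i, j) = v"
    using sums[OF ij] f cornerD(4)[OF F] by (simp add: sums_unique2)
  moreover have "M $$ (k, l) = 0" if "i \<le> k" "k < n" "l \<le> j" "(k, l) \<noteq> (i, j)" for k l
  proof -
    have "F t $$ (k, l) = 0" for t using F[of t] that unfolding corner_def by blast
    then show ?thesis using sums[of k l] that ij by (simp add: sums_iff)
  qed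
  ultimately show ?thesis using M ij by (simp add: corner_def)
qed

text \<open>Take the last nonzero row and its first nonzero entry.\<close>

lemma exists_corner:
  assumes m: "m \<in> carrier_mat n n" "m \<noteq> 0\<^sub>m n n"
  shows "\<exists>i j v. v \<noteq> 0 \<and> corner n i j m v"
proof -
  let ?R = "{k. k < n \<and> (\<exists>l<n. m $$ (k, l) \<noteq> 0)}"
  have "\<exists>k<n. \<exists>l<n. m $$ (k, l) \<noteq> 0"
  proof (rule ccontr)
    assume "\<not> ?thesis"
    then have "m = 0\<^sub>m n n" using m by (intro eq_matI) auto
    then show False using m by simp
  qed
  then have R: "finite ?R" "?R \<noteq> {}" by auto
  define i where "i = Max ?R"
  have i: "i < n" "\<exists>l. l < n \<and> m $$ (i, l) \<noteq> 0" using Max_in[OF R] by (auto simp: i_def)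
  define j where "j = (LEAST l. l < n \<and> m $$ (i, l) \<noteq> 0)"
  have j: "j < n" "m $$ (i, j) \<noteq> 0" using LeastI_ex[OF i(2)] by (auto simp: j_def)
  have "m $$ (k, l) = 0" if kl: "i \<le> k" "k < n" "l \<le> j" "(k, l) \<noteq> (i, j)" for k l
  proof (cases "k = i")
    case True
    then have "l < j" using kl by auto
    then show ?thesis using not_less_Least[of l "\<lambda>l. l < n \<and> m $$ (i, l) \<noteq> 0"] j True
      by (auto simp: j_def)
  next
    case False
    then have "k \<notin> ?R" using Max_ge[OF R(1), of k] kl unfolding i_def by linarith
    then show ?thesis using kl j by auto
  qed
  then show ?thesis using m i j by (intro exI[of _ i] exI[of _ j] exI[of _ "m $$ (i, j)"]) (auto simp: corner_def)
qed

text \<open>Every position on or below the diagonal is a corner, so the product rules for corners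
  also yield the rules for products of triangular matrices.\<close>

lemma upper_triangular_corner:
  assumes "A \<in> carrier_mat n n" "upper_triangular A" "j \<le> i" "i < n"
  shows "corner n i j A (A $$ (i, j))"
  using assms upper_triangularD[OF assms(2)] by (auto simp: corner_def)

lemma upper_triangular_mult:
  fixes A B :: "complex mat"
  assumes "A \<in> carrier_mat n n" "B \<in> carrier_mat n n" "upper_triangular A" "upper_triangular B"
  shows "upper_triangular (A * B)"
    and "i < n \<Longrightarrow> (A * B) $$ (i, i) = A $$ (i, i) * B $$ (i, i)"
proof -
  have *: "(A * B) $$ (i, j) = A $$ (i, i) * B $$ (i, j)" if "j \<le> i" "i < n" for i j
    using corner_mult_left[OF assms(1,3) upper_triangular_corner[OF assms(2,4) that]] by (rule cornerD)
  then show "i < n \<Longrightarrow> (A * B) $$ (i, i) = A $$ (i, i) * B $$ (i, i)" by simp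
  show "upper_triangular (A * B)"
    using * upper_triangularD[OF assms(4)] assms(1,2) by (intro upper_triangularI) auto
qed

lemma upper_triangular_pow:
  fixes A :: "complex mat"
  assumes A: "A \<in> carrier_mat n n" "upper_triangular A"
  shows "upper_triangular (A ^\<^sub>m k)"
    and "i < n \<Longrightarrow> (A ^\<^sub>m k) $$ (i, i) = (A $$ (i, i)) ^ k"
proof -
  have "upper_triangular (A ^\<^sub>m k) \<and> (\<forall>i<n. (A ^\<^sub>m k) $$ (i, i) = (A $$ (i, i)) ^ k)"
    using A upper_triangular_mult[of "A ^\<^sub>m _" n A]
    by (induction k) (auto simp: pow_carrier_mat)
  then show "upper_triangular (A ^\<^sub>m k)" "i < n \<Longrightarrow> (A ^\<^sub>m k) $$ (i, i) = (A $$ (i, i)) ^ k" by auto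
qed

lemma upper_triangular_mat_exp:
  assumes A: "A \<in> carrier_mat n n" "upper_triangular A"
  shows "upper_triangular (mat_exp A)"
    and "i < n \<Longrightarrow> mat_exp A $$ (i, i) = exp (A $$ (i, i))"
proof -
  show "upper_triangular (mat_exp A)"
  proof (rule upper_triangularI)
    fix i j assume ij: "j < i" "i < dim_row (mat_exp A)"
    then have "i < n" using mat_exp_carrier[OF A(1)] by auto
    then show "mat_exp A $$ (i, j) = 0"
      using mat_exp_sums[OF A(1), of i j] upper_triangularD[OF upper_triangular_pow(1)[OF A], of j i] ij A
      by (simp add: sums_iff pow_carrier_mat)
  qed
  show "mat_exp A $$ (i, i) = exp (A $$ (i, i))" if "i < n"
    using mat_exp_sums[OF A(1) that that] exp_converges[of "A $$ (i, i)"]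
    by (simp add: upper_triangular_pow(2)[OF A that] sums_iff scaleR_conv_of_real field_simps)
qed

text \<open>The recursion produces the divided differences of the powers \<open>z ^ t\<close> at
  \<open>u\<close> and \<open>v\<close>: \<open>h t\<close> is the sum of all
  \<open>u ^ r * v ^ s\<close> with \<open>r + s + 1 = t\<close>.\<close>

lemma exp_dd_sums:
  assumes h0: "h 0 = 0" and h: "\<And>t. h (Suc t) = u ^ t + h t * v"
  shows "(\<lambda>t. h t / fact t) sums exp_dd u v"
proof (cases "u = v")
  case True
  have "h t * u = of_nat t * u ^ t \<and> h (Suc t) = of_nat (Suc t) * u ^ t" for t
  proof (induction t)
    case 0
    then show ?case using h[of 0] by (simp add: h0)
  next
    case (Suc t)
    then show ?case using h[of "Suc t"] True by (simp add: algebra_simps)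
  qed
  then have hS: "h (Suc t) = of_nat (Suc t) * u ^ t" for t by blast
  have "(\<lambda>t. h (Suc t) / fact (Suc t)) = (\<lambda>t. u ^ t /\<^sub>R fact t)"
    unfolding hS by (simp add: scaleR_conv_of_real field_simps del: of_nat_Suc)
  then have "(\<lambda>t. h (Suc t) / fact (Suc t)) sums exp u" using exp_converges[of u] by simp
  then show ?thesis using True h0 by (subst (asm) sums_Suc_iff) (simp add: exp_dd_def)
next
  case False
  have "h t * (u - v) = u ^ t - v ^ t" for t
    proof (induction t)
    case (Suc t)
    have "h (Suc t) * (u - v) = u ^ t * (u - v) + v * (h t * (u - v))" by (simp add: h algebra_simps)
    then show ?case unfolding Suc by (simp add: algebra_simps)
  qed (simp add: h0)
  then have ht: "h t = (u ^ t - v ^ t) / (u - v)" for t using False by (simp add: field_simps)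
  have "(\<lambda>t. (u ^ t /\<^sub>R fact t - v ^ t /\<^sub>R fact t) / (u - v)) sums ((exp u - exp v) / (u - v))"
    by (intro sums_divide sums_diff exp_converges)
  moreover have "(\<lambda>t. (u ^ t /\<^sub>R fact t - v ^ t /\<^sub>R fact t) / (u - v)) = (\<lambda>t. h t / fact t)"
    unfolding ht by (simp add: scaleR_conv_of_real field_simps)
  ultimately show ?thesis using False by (simp add: exp_dd_def)
qed

text \<open>For powers, \<open>A * m - m * B\<close> telescopes into summands with powers of
  \<open>A\<close> on the left and of \<open>B\<close> on the right. The corner sees only their
  diagonal entries, so \<open>d\<close> gets multiplied by a divided difference. The main uses are
  \<open>A = B\<close>, giving commutators, and \<open>m\<close> the identity, giving
  perturbations.\<close>

lemma corner_mat_exp: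
  assumes A: "A \<in> carrier_mat n n" "upper_triangular A"
    and B: "B \<in> carrier_mat n n" "upper_triangular B"
    and m: "m \<in> carrier_mat n n" and d: "corner n i j (A * m - m * B) d"
  shows "corner n i j (mat_exp A * m - m * mat_exp B) (d * exp_dd (A $$ (i, i)) (B $$ (j, j)))"
proof (rule corner_sums)
  note ij = cornerD(2,3)[OF d]
  define u v where "u = A $$ (i, i)" and "v = B $$ (j, j)"
  define h where "h = rec_nat 0 (\<lambda>t x. u ^ t + x * v)"
  have h: "h 0 = 0" "h (Suc t) = u ^ t + h t * v" for t by (simp_all add: h_def)
  show "corner n i j (A ^\<^sub>m t * m - m * B ^\<^sub>m t) (d * h t)" for t
  proof (induction t)
    case 0
    have "A ^\<^sub>m 0 * m - m * B ^\<^sub>m 0 = 0\<^sub>m n n" using A B m by auto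
    then show ?case using corner_zero[OF ij] by (simp add: h)
  next
    case (Suc t)
    have "A ^\<^sub>m Suc t * m - m * B ^\<^sub>m Suc t
        = A ^\<^sub>m t * (A * m - m * B) + (A ^\<^sub>m t * m - m * B ^\<^sub>m t) * B"
      using A(1) B(1) m by (simp add: square_mat_simps[where n = n])
        (rule eq_matI; simp add: square_mat_simps[where n = n])
    moreover have "corner n i j (A ^\<^sub>m t * (A * m - m * B)) (u ^ t * d)"
      using corner_mult_left[OF pow_carrier_mat[OF A(1)] upper_triangular_pow(1)[OF A] d]
        upper_triangular_pow(2)[OF A ij(1)] by (simp add: u_def)
    moreover have "corner n i j ((A ^\<^sub>m t * m - m * B ^\<^sub>m t) * B) (d * h t * v)"
      using corner_mult_right[OF B Suc] by (simp add: v_def)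
    ultimately show ?case using corner_add by (fastforce simp: h algebra_simps)
  qed
  show "(\<lambda>t. d * h t / fact t) sums (d * exp_dd (A $$ (i, i)) (B $$ (j, j)))"
    using sums_mult[OF exp_dd_sums[of h u v], of d] h by (simp add: u_def v_def)
  show "mat_exp A * m - m * mat_exp B \<in> carrier_mat n n"
    using A B m by (simp add: minus_carrier_mat)
  fix k l assume kl: "k < n" "l < n"
  have "(\<lambda>t. (A ^\<^sub>m t * m) $$ (k, l) / fact t - (m * B ^\<^sub>m t) $$ (k, l) / fact t) sums
      ((mat_exp A * m) $$ (k, l) - (m * mat_exp B) $$ (k, l))"
    using A B m kl by (intro sums_diff mat_exp_mult_sums mult_mat_exp_sums)
  then show "(\<lambda>t. (A ^\<^sub>m t * m - m * B ^\<^sub>m t) $$ (k, l) / fact t) sums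
      ((mat_exp A * m - m * mat_exp B) $$ (k, l))"
    using A(1) B(1) m kl pow_carrier_mat[OF A(1)] pow_carrier_mat[OF B(1)]  mat_exp_carrier[OF A(1)] mat_exp_carrier[OF B(1)]
    by (simp add: diff_divide_distrib)
qed

section \<open>The principal logarithm of a triangularizable matrix\<close>

lemma upper_triangular_eigenvalue_iff:
  fixes A :: "complex mat"
  assumes A: "A \<in> carrier_mat n n" "upper_triangular A"
  shows "eigenvalue A z \<longleftrightarrow> (\<exists>i<n. z = A $$ (i, i))"
proof -
  have "eigenvalue A z \<longleftrightarrow> z \<in> set (diag_mat A)"
    unfolding eigenvalue_root_char_poly[OF A(1)] char_poly_upper_triangular[OF A]
    by (auto simp: poly_prod_list prod_list_zero_iff)
  then show ?thesis using A by (auto simp: diag_mat_def)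
qed

lemma similar_mat_wit_eigenvalue_iff:
  fixes x a :: "complex mat"
  assumes "similar_mat_wit x a p q"
  shows "eigenvalue x z \<longleftrightarrow> eigenvalue a z"
proof -
  have "char_poly x = char_poly a" using assms by (intro char_poly_similar) (auto simp: similar_mat_def)
  then show ?thesis
    unfolding eigenvalue_root_char_poly[OF similar_mat_witD(4)[OF refl assms]]
      eigenvalue_root_char_poly[OF similar_mat_witD(5)[OF refl assms]] by simp
qed

lemma schur_similar_mat_wit:
  fixes a :: "complex mat"
  assumes a: "a \<in> carrier_mat n n"
  shows "\<exists>A p q. similar_mat_wit a A p q \<and> upper_triangular A"
proof -
  from char_poly_factorized[OF a] obtain es where "char_poly a = (\<Prod>e\<leftarrow>es. [:- e, 1:])" by blast
  from schur_decomposition_exists[OF a this] show ?thesis by (auto simp: similar_mat_def)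
qed

text \<open>A converse of \<open>mat_exp_intertwine\<close>: a nonzero corner of
  \<open>A * m - m * B\<close> would survive in the exponentials, multiplied by a nonzero divided
  difference.\<close>

lemma upper_triangular_mat_exp_intertwine:
  assumes A: "A \<in> carrier_mat n n" "upper_triangular A"
    and B: "B \<in> carrier_mat n n" "upper_triangular B"
    and sA: "\<And>i. i < n \<Longrightarrow> \<bar>Im (A $$ (i, i))\<bar> < pi"
    and sB: "\<And>i. i < n \<Longrightarrow> \<bar>Im (B $$ (i, i))\<bar> < pi"
    and m: "m \<in> carrier_mat n n" and eq: "mat_exp A * m = m * mat_exp B"
  shows "A * m = m * B"
proof -
  have AB: "A * m \<in> carrier_mat n n" "m * B \<in> carrier_mat n n" using A B m by auto
  have "A * m - m * B = 0\<^sub>m n n"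
  proof (rule ccontr)
    assume "A * m - m * B \<noteq> 0\<^sub>m n n"
    then obtain i j v where v: "v \<noteq> 0" and c: "corner n i j (A * m - m * B) v"
      using exists_corner[of "A * m - m * B" n] AB by (auto simp: minus_carrier_mat)
    have ij: "i < n" "j < n" using cornerD[OF c] by auto
    have "mat_exp A * m - m * mat_exp B = 0\<^sub>m n n" unfolding eq using m B by auto
    then have "v * exp_dd (A $$ (i, i)) (B $$ (j, j)) = 0"
      using cornerD(4)[OF corner_mat_exp[OF A B m c]] ij by simp
    moreover have "exp_dd (A $$ (i, i)) (B $$ (j, j)) \<noteq> 0"
      using sA[OF ij(1)] sB[OF ij(2)] by (intro exp_dd_nonzero) auto
    ultimately show False using v by simp
  qed
  show ?thesis
  proof (rule eq_matI)
    fix i j assume ij: "i < dim_row (m * B)" "j < dim_col (m * B)"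
    then have "i < n" "j < n" using m B by auto
    then have "(A * m - m * B) $$ (i, j) = 0" by (simp add: \<open>A * m - m * B = 0\<^sub>m n n\<close>)
    then show "(A * m) $$ (i, j) = (m * B) $$ (i, j)" using ij AB by simp
  qed (use A B m in auto)
qed

text \<open>Triangularize \<open>a\<close> and \<open>b\<close> separately; the change of basis then intertwines the exponentials
  of the two triangular forms.\<close>

lemma mat_exp_inj_strip:
  assumes a: "a \<in> carrier_mat n n" and b: "b \<in> carrier_mat n n"
    and sa: "\<And>z. eigenvalue a z \<Longrightarrow> \<bar>Im z\<bar> < pi" and sb: "\<And>z. eigenvalue b z \<Longrightarrow> \<bar>Im z\<bar> < pi"
    and eq: "mat_exp a = mat_exp b"
  shows "a = b"
proof -
  obtain A p q where A: "similar_mat_wit a A p q" "upper_triangular A"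
    using schur_similar_mat_wit[OF a] by blast
  obtain B r s where B: "similar_mat_wit b B r s" "upper_triangular B"
    using schur_similar_mat_wit[OF b] by blast
  note Aw = similar_mat_witD2[OF a A(1)] note Bw = similar_mat_witD2[OF b B(1)]
  have qr: "q * r \<in> carrier_mat n n" using Aw Bw by simp
  \<comment> \<open>\<open>left\<close> and \<open>right\<close> are needed twice each, for the
    matrices themselves and for their exponentials.\<close>
  have left: "Y * (q * r) = q * X * r"
    if "X \<in> carrier_mat n n" "Y \<in> carrier_mat n n" "X = p * Y * q" for X Y
  proof -
    have "q * X * r = (q * p) * Y * (q * r)"
      unfolding that(3) using that(2) Aw(6,7) Bw(6) by (simp add: square_mat_simps[where n = n])
    then show ?thesis using that(2) Aw(2) qr by simp
  qed
  have right: "(q * r) * Y = q * X * r"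
    if "X \<in> carrier_mat n n" "Y \<in> carrier_mat n n" "X = r * Y * s" for X Y
  proof -
    have "q * X * r = (q * r) * Y * (s * r)"
      unfolding that(3) using that(2) Aw(6,7) Bw(6,7) by (simp add: square_mat_simps[where n = n])
    then show ?thesis using that(2) Bw(2) qr right_mult_one_mat[of "q * r * Y" n n] by simp
  qed
  have "A * (q * r) = (q * r) * B"
  proof (rule upper_triangular_mat_exp_intertwine[OF Aw(5) A(2) Bw(5) B(2) _ _ qr])
    show "\<bar>Im (A $$ (i, i))\<bar> < pi" if "i < n" for i
      using sa similar_mat_wit_eigenvalue_iff[OF A(1)] upper_triangular_eigenvalue_iff[OF Aw(5) A(2)] that
      by blast
    show "\<bar>Im (B $$ (i, i))\<bar> < pi" if "i < n" for i
      using sb similar_mat_wit_eigenvalue_iff[OF B(1)] upper_triangular_eigenvalue_iff[OF Bw(5) B(2)] that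
      by blast
    have "mat_exp A * (q * r) = q * mat_exp a * r"
      using similar_mat_witD2(3)[OF mat_exp_carrier[OF a] mat_exp_similar[OF A(1)]]
      by (intro left mat_exp_carrier a Aw(5))
    moreover have "(q * r) * mat_exp B = q * mat_exp b * r"
      using similar_mat_witD2(3)[OF mat_exp_carrier[OF b] mat_exp_similar[OF B(1)]]
      by (intro right mat_exp_carrier b Bw(5))
    ultimately show "mat_exp A * (q * r) = (q * r) * mat_exp B" using eq by simp
  qed
  then have "q * a * r = q * b * r"
    using left[OF a Aw(5,3)] right[OF b Bw(5,3)] by simp
  then have "p * (q * a * r) * s = p * (q * b * r) * s" by simp
  moreover have "p * (q * X * r) * s = X" if X: "X \<in> carrier_mat n n" for X
  proof -
    have "p * (q * X * r) * s = (p * q) * X * (r * s)"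
      using X Aw(6,7) Bw(6,7) by (simp add: square_mat_simps[where n = n])
    then show ?thesis using X Aw(1) Bw(1) by simp
  qed
  ultimately show ?thesis using a b by metis
qed

lemma complex_log_exists:
  assumes "z \<notin> \<real>\<^sub>\<le>\<^sub>0"
  shows "\<exists>w. exp w = z \<and> \<bar>Im w\<bar> < pi"
proof -
  have z0: "z \<noteq> 0" using assms by auto
  define w where "w = Complex (ln (cmod z)) (Arg z)"
  have "exp w = rcis (cmod z) (Arg z)" using z0 by (simp add: w_def exp_eq_polar rcis_def)
  then have e: "exp w = z" by (simp add: rcis_cmod_Arg)
  \<comment> \<open>The argument \<open>pi\<close> occurs only on the excluded half-line.\<close>
  have "Arg z \<noteq> pi"
  proof
    assume "Arg z = pi"
    then have "z = - of_real (cmod z)" using rcis_cmod_Arg[of z] by (simp add: rcis_def)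
    then have "z = of_real (- cmod z)" by simp
    then have "z \<in> \<real>\<^sub>\<le>\<^sub>0" by (metis nonpos_Reals_of_real_iff neg_le_0_iff_le norm_ge_zero)
    then show False using assms by simp
  qed
  then have "\<bar>Im w\<bar> < pi" using Arg_bounded[of z] by (auto simp: w_def abs_less_iff)
  then show ?thesis using e by blast
qed

text \<open>The superdiagonals of the logarithm are found one after the other: changing the \<open>g\<close>-th
  superdiagonal of \<open>a\<close> leaves the earlier superdiagonals of \<open>mat_exp a\<close> alone and changes the
  \<open>g\<close>-th one by nonzero factors.\<close>

lemma upper_triangular_log_exists:
  fixes x :: "complex mat"
  assumes x: "x \<in> carrier_mat n n" "upper_triangular x"
    and nonpos: "\<And>i. i < n \<Longrightarrow> x $$ (i, i) \<notin> \<real>\<^sub>\<le>\<^sub>0"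
  shows "\<exists>a \<in> carrier_mat n n. upper_triangular a \<and> mat_exp a = x \<and> (\<forall>i<n. \<bar>Im (a $$ (i, i))\<bar> < pi)"
proof -
  \<comment> \<open>The bound includes superdiagonal \<open>g\<close> and everything below it; stage
    \<open>0\<close> settles the diagonal, and stage \<open>n\<close> covers the whole
    matrix.\<close>
  have "\<exists>a \<in> carrier_mat n n. upper_triangular a \<and> (\<forall>i<n. \<bar>Im (a $$ (i, i))\<bar> < pi) \<and>
      (\<forall>i<n. \<forall>j<n. j < i + Suc g \<longrightarrow> mat_exp a $$ (i, j) = x $$ (i, j))" for g
  proof (induction g)
    case 0
    obtain w where w: "\<And>i. i < n \<Longrightarrow> exp (w i) = x $$ (i, i) \<and> \<bar>Im (w i)\<bar> < pi"
      using complex_log_exists[OF nonpos] by metis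
    define a where "a = mat n n (\<lambda>(i, j). if i = j then w i else 0)"
    have a: "a \<in> carrier_mat n n" "upper_triangular a" by (auto simp: a_def)
    have "mat_exp a $$ (i, j) = x $$ (i, j)" if "i < n" "j < n" "j < i + 1" for i j
    proof (cases "i = j")
      case True
      then show ?thesis using that w upper_triangular_mat_exp(2)[OF a, of i] by (simp add: a_def)
    next
      case False
      then show ?thesis using that upper_triangularD[OF upper_triangular_mat_exp(1)[OF a], of j i]
          upper_triangularD[OF x(2), of j i] a x by simp
    qed
    then show ?case using a w by (intro bexI[of _ a]) (auto simp: a_def)
  next
    case (Suc g)
    then obtain a where a: "a \<in> carrier_mat n n" "upper_triangular a"
      and s: "\<And>i. i < n \<Longrightarrow> \<bar>Im (a $$ (i, i))\<bar> < pi"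
      and e: "\<And>i j. i < n \<Longrightarrow> j < n \<Longrightarrow> j < i + Suc g \<Longrightarrow> mat_exp a $$ (i, j) = x $$ (i, j)"
      by blast
    \<comment> \<open>The missing amount on the next superdiagonal, divided by the factor with which
      \<open>mat_exp\<close> responds to a change there.\<close>
    define d where "d = mat n n (\<lambda>(i, j). if j = i + Suc g
      then (x $$ (i, j) - mat_exp a $$ (i, j)) / exp_dd (a $$ (i, i)) (a $$ (j, j)) else 0)"
    have d: "d \<in> carrier_mat n n" by (simp add: d_def)
    have A: "a + d \<in> carrier_mat n n" "upper_triangular (a + d)"
      using a upper_triangularD[OF a(2)] by (auto simp: d_def)
    have diag: "(a + d) $$ (i, i) = a $$ (i, i)" if "i < n" for i
      using that a by (simp add: d_def)
    have "mat_exp (a + d) $$ (i, j) = x $$ (i, j)" if ij: "i < n" "j < n" "j < i + Suc (Suc g)" for i j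
    proof -
      \<comment> \<open>With the identity as middle factor, \<open>corner_mat_exp\<close> measures
        the effect of adding \<open>d\<close>. As \<open>d\<close> lives on a single superdiagonal,
        every position considered is a corner of it.\<close>
      have "(a + d) * 1\<^sub>m n - 1\<^sub>m n * a = d" using a d by (intro eq_matI) auto
      moreover have "corner n i j d (d $$ (i, j))"
        using ij by (auto simp: corner_def d_def)
      ultimately have "corner n i j (mat_exp (a + d) * 1\<^sub>m n - 1\<^sub>m n * mat_exp a)
          (d $$ (i, j) * exp_dd ((a + d) $$ (i, i)) (a $$ (j, j)))"
        using corner_mat_exp[OF A a, of "1\<^sub>m n"] by simp
      then have "mat_exp (a + d) $$ (i, j) - mat_exp a $$ (i, j) = d $$ (i, j) * exp_dd (a $$ (i, i)) (a $$ (j, j))"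
        using cornerD(4) ij a A diag[OF ij(1)] right_mult_one_mat[OF mat_exp_carrier[OF A(1)]]
          left_mult_one_mat[OF mat_exp_carrier[OF a(1)]] by fastforce
      moreover have "exp_dd (a $$ (i, i)) (a $$ (j, j)) \<noteq> 0"
        using s[OF ij(1)] s[OF ij(2)] by (intro exp_dd_nonzero) auto
      ultimately show ?thesis
        using ij e[OF ij(1,2)] by (cases "j = i + Suc g") (auto simp: d_def)
    qed
    then show ?case using A s diag by (intro bexI[of _ "a + d"]) auto
  qed
  from this[of n] obtain a where a: "a \<in> carrier_mat n n" "upper_triangular a"
      "\<And>i. i < n \<Longrightarrow> \<bar>Im (a $$ (i, i))\<bar> < pi"
      "\<And>i j. i < n \<Longrightarrow> j < n \<Longrightarrow> j < i + Suc n \<Longrightarrow> mat_exp a $$ (i, j) = x $$ (i, j)"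
    by blast
  moreover have "mat_exp a = x" using a x by (intro eq_matI) auto
  ultimately show ?thesis by blast
qed

text \<open>Evaluates the definite description. The point is that \<open>p\<close> and
  \<open>q\<close> stay the same: a basis triangularizing several matrices triangularizes their
  logarithms too.\<close>

lemma mat_log_triangularizable:
  assumes x: "x \<in> carrier_mat n n" and sim: "similar_mat_wit x X p q" and X: "upper_triangular X"
    and nonpos: "\<forall>z \<in> \<real>\<^sub>\<le>\<^sub>0. \<not> eigenvalue x z"
  shows "\<exists>a. similar_mat_wit (mat_log x) a p q \<and> upper_triangular a \<and> mat_exp a = X \<and>
    (\<forall>i<n. \<bar>Im (a $$ (i, i))\<bar> < pi)"
proof -
  note w = similar_mat_witD2[OF x sim]
  have "X $$ (i, i) \<notin> \<real>\<^sub>\<le>\<^sub>0" if "i < n" for i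
    using nonpos similar_mat_wit_eigenvalue_iff[OF sim] upper_triangular_eigenvalue_iff[OF w(5) X] that by blast
  then obtain a where a: "a \<in> carrier_mat n n" "upper_triangular a" "mat_exp a = X"
    "\<And>i. i < n \<Longrightarrow> \<bar>Im (a $$ (i, i))\<bar> < pi"
    using upper_triangular_log_exists[OF w(5) X] by blast
  have sim_a: "similar_mat_wit (p * a * q) a p q"
    using a w by (intro similar_mat_witI[of _ _ n]) auto
  have l: "p * a * q \<in> carrier_mat n n" using a w by auto
  have el: "mat_exp (p * a * q) = x"
    using similar_mat_witD2(3)[OF mat_exp_carrier[OF l] mat_exp_similar[OF sim_a]] a w(3) by simp
  have str: "\<bar>Im z\<bar> < pi" if "eigenvalue (p * a * q) z" for z
    using that a(4) unfolding similar_mat_wit_eigenvalue_iff[OF sim_a] upper_triangular_eigenvalue_iff[OF a(1,2)]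
    by auto
  have dim: "dim_row x = n" using x by simp
  have "mat_log x = p * a * q"
    unfolding mat_log_def dim
  proof (rule the_equality)
    show "p * a * q \<in> carrier_mat n n \<and> mat_exp (p * a * q) = x \<and>
      (\<forall>z. eigenvalue (p * a * q) z \<longrightarrow> - pi < Im z \<and> Im z < pi)"
      using l el str unfolding abs_less_iff by (metis minus_less_iff)
    fix b assume b: "b \<in> carrier_mat n n \<and> mat_exp b = x \<and>
      (\<forall>z. eigenvalue b z \<longrightarrow> - pi < Im z \<and> Im z < pi)"
    show "b = p * a * q"
    proof (rule mat_exp_inj_strip[of b n])
      show "\<bar>Im z\<bar> < pi" if "eigenvalue b z" for z
        using b that unfolding abs_less_iff by (metis minus_less_iff)
      show "mat_exp b = mat_exp (p * a * q)" using b el by metis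
    qed (use b l str in blast)+
  qed
  then have "similar_mat_wit (mat_log x) a p q" using sim_a by (simp only:)
  then show ?thesis using a by blast
qed

section \<open>Additivity of logarithms implies commutativity\<close>

lemma sum_binomial_Suc:
  fixes g :: "nat \<Rightarrow> complex"
  shows "(\<Sum>m\<le>Suc k. of_nat (Suc k choose m) * g m)
    = (\<Sum>m\<le>k. of_nat (k choose m) * (g (Suc m) + g m))"
proof -
  have "(\<Sum>m\<le>k. of_nat (k choose m) * g m) = (\<Sum>m\<le>Suc k. of_nat (k choose m) * g m)" by simp
  also have "\<dots> = g 0 + (\<Sum>m\<le>k. of_nat (k choose Suc m) * g (Suc m))"
    by (subst sum.atMost_Suc_shift) simp
  finally have *: "(\<Sum>m\<le>k. of_nat (k choose m) * g m)
      = g 0 + (\<Sum>m\<le>k. of_nat (k choose Suc m) * g (Suc m))" .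
  show ?thesis
    unfolding distrib_left sum.distrib * by (subst sum.atMost_Suc_shift) (simp add: sum.distrib algebra_simps)
qed

text \<open>The expansion of \<open>(a + b) ^ k\<close> with all factors \<open>a\<close> moved to the left of all factors \<open>b\<close>.\<close>

primrec ordered_binomial :: "nat \<Rightarrow> complex mat \<Rightarrow> complex mat \<Rightarrow> nat \<Rightarrow> complex mat" where
  "ordered_binomial n a b 0 = 1\<^sub>m n"
| "ordered_binomial n a b (Suc k) = a * ordered_binomial n a b k + ordered_binomial n a b k * b"

lemma ordered_binomial_carrier [simp]:
  "a \<in> carrier_mat n n \<Longrightarrow> b \<in> carrier_mat n n \<Longrightarrow> ordered_binomial n a b k \<in> carrier_mat n n"
  by (induction k) auto

lemma dim_ordered_binomial [simp]:
  assumes "a \<in> carrier_mat n n" "b \<in> carrier_mat n n"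
  shows "dim_row (ordered_binomial n a b k) = n" "dim_col (ordered_binomial n a b k) = n"
  using ordered_binomial_carrier[OF assms, of k] by (simp_all del: ordered_binomial_carrier)

text \<open>With \<open>t\<close> the \<open>k\<close>-th ordered binomial, this is the recursion
  for its commutator with \<open>a\<close>.\<close>

lemma commutator_ordered_product:
  fixes a b t :: "complex mat"
  assumes "a \<in> carrier_mat n n" "b \<in> carrier_mat n n" "t \<in> carrier_mat n n"
  shows "(a * t + t * b) * a - a * (a * t + t * b)
    = a * (t * a - a * t) + (t * a - a * t) * b + t * (b * a - a * b)"
  using assms by (simp add: square_mat_simps[where n = n]) (rule eq_matI; simp)

text \<open>With \<open>s\<close> the \<open>k\<close>-th power of \<open>a + b\<close> and
  \<open>t\<close> the \<open>k\<close>-th ordered binomial, this is the recursion for their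
  difference.\<close>

lemma ordered_product_defect:
  fixes a b t s :: "complex mat"
  assumes "a \<in> carrier_mat n n" "b \<in> carrier_mat n n" "t \<in> carrier_mat n n" "s \<in> carrier_mat n n"
  shows "s * (a + b) - (a * t + t * b) = (s - t) * (a + b) + (t * a - a * t)"
  using assms by (simp add: square_mat_simps[where n = n]) (rule eq_matI; simp)

lemma add_commutator:
  fixes a b :: "complex mat"
  assumes "a \<in> carrier_mat n n" "b \<in> carrier_mat n n"
  shows "(a + b) * a - a * (a + b) = b * a - a * b" "(a + b) * b - b * (a + b) = a * b - b * a"
  using assms by (simp_all add: square_mat_simps[where n = n]) (rule eq_matI; simp)+

lemma pow_mat_Suc_left:
  assumes "b \<in> carrier_mat n n"
  shows "b * b ^\<^sub>m k = b ^\<^sub>m Suc k"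
  using assms by (induction k) (simp_all flip: assoc_mult_mat[of b n n _ n b n] add: pow_carrier_mat)

lemma ordered_binomial_entry:
  assumes a: "a \<in> carrier_mat n n" and b: "b \<in> carrier_mat n n" and ij: "i < n" "j < n"
  shows "ordered_binomial n a b k $$ (i, j)
    = (\<Sum>m\<le>k. of_nat (k choose m) * (a ^\<^sub>m m * b ^\<^sub>m (k - m)) $$ (i, j))"
proof -
  let ?T = "ordered_binomial n a b"
  \<comment> \<open>The outer powers make the induction go through: they absorb the new factor
    \<open>a\<close> on the left or \<open>b\<close> on the right.\<close>
  have "(a ^\<^sub>m p * ?T k * b ^\<^sub>m q) $$ (i, j)
    = (\<Sum>m\<le>k. of_nat (k choose m) * (a ^\<^sub>m (p + m) * b ^\<^sub>m (q + k - m)) $$ (i, j))" for p q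
  proof (induction k arbitrary: p q)
    case 0
    then show ?case using a b by (simp add: pow_carrier_mat)
  next
    case (Suc k)
    have "a ^\<^sub>m p * ?T (Suc k) * b ^\<^sub>m q = a ^\<^sub>m p * (a * ?T k) * b ^\<^sub>m q + a ^\<^sub>m p * (?T k * b) * b ^\<^sub>m q"
      using a b by (simp add: square_mat_simps[where n = n])
    also have "a ^\<^sub>m p * (a * ?T k) * b ^\<^sub>m q = a ^\<^sub>m Suc p * ?T k * b ^\<^sub>m q"
      using a b by (simp add: square_mat_simps[where n = n])
    also have "a ^\<^sub>m p * (?T k * b) * b ^\<^sub>m q = a ^\<^sub>m p * ?T k * b ^\<^sub>m Suc q"
      unfolding pow_mat_Suc_left[OF b, symmetric] using a b by (simp add: square_mat_simps[where n = n])
    finally have "(a ^\<^sub>m p * ?T (Suc k) * b ^\<^sub>m q) $$ (i, j)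
        = (a ^\<^sub>m Suc p * ?T k * b ^\<^sub>m q) $$ (i, j) + (a ^\<^sub>m p * ?T k * b ^\<^sub>m Suc q) $$ (i, j)"
      using a b ij by simp
    also have "\<dots> = (\<Sum>m\<le>k. of_nat (k choose m) *
        ((a ^\<^sub>m (p + Suc m) * b ^\<^sub>m (q + Suc k - Suc m)) $$ (i, j) + (a ^\<^sub>m (p + m) * b ^\<^sub>m (q + Suc k - m)) $$ (i, j)))"
      unfolding Suc.IH by (simp add: sum.distrib algebra_simps del: pow_mat.simps)
    also have "\<dots> = (\<Sum>m\<le>Suc k. of_nat (Suc k choose m) * (a ^\<^sub>m (p + m) * b ^\<^sub>m (q + Suc k - m)) $$ (i, j))"
      by (rule sum_binomial_Suc[symmetric])
    finally show ?case .
  qed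
  from this[of 0 0] show ?thesis using a b ordered_binomial_carrier[OF a b, of k] by simp
qed

text \<open>The Cauchy product of the two series; since all \<open>a\<close> stand to the left of
  all \<open>b\<close>, no commutation is required.\<close>

lemma mat_exp_mult_mat_exp_sums:
  assumes a: "a \<in> carrier_mat n n" and b: "b \<in> carrier_mat n n" and ij: "i < n" "j < n"
  shows "(\<lambda>k. ordered_binomial n a b k $$ (i, j) / fact k) sums ((mat_exp a * mat_exp b) $$ (i, j))"
proof -
  have "(\<lambda>k. \<Sum>l<n. \<Sum>m\<le>k. ((a ^\<^sub>m m) $$ (i, l) / fact m) * ((b ^\<^sub>m (k - m)) $$ (l, j) / fact (k - m))) sums
      (\<Sum>l<n. (\<Sum>k. (a ^\<^sub>m k) $$ (i, l) / fact k) * (\<Sum>k. (b ^\<^sub>m k) $$ (l, j) / fact k))"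
    using a b ij by (intro sums_sum Cauchy_product_sums mat_exp_summable_norm) auto
  also have "(\<Sum>l<n. (\<Sum>k. (a ^\<^sub>m k) $$ (i, l) / fact k) * (\<Sum>k. (b ^\<^sub>m k) $$ (l, j) / fact k))
      = (mat_exp a * mat_exp b) $$ (i, j)"
    using a b ij by (simp add: mult_mat_entry[of _ n n _ n] mat_exp_def)
  also have "(\<lambda>k. \<Sum>l<n. \<Sum>m\<le>k. ((a ^\<^sub>m m) $$ (i, l) / fact m) * ((b ^\<^sub>m (k - m)) $$ (l, j) / fact (k - m)))
      = (\<lambda>k. ordered_binomial n a b k $$ (i, j) / fact k)"
  proof
    fix k
    have "(\<Sum>l<n. \<Sum>m\<le>k. ((a ^\<^sub>m m) $$ (i, l) / fact m) * ((b ^\<^sub>m (k - m)) $$ (l, j) / fact (k - m)))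
        = (\<Sum>m\<le>k. \<Sum>l<n. ((a ^\<^sub>m m) $$ (i, l) / fact m) * ((b ^\<^sub>m (k - m)) $$ (l, j) / fact (k - m)))"
      by (rule sum.swap)
    also have "\<dots> = (\<Sum>m\<le>k. of_nat (k choose m) * (a ^\<^sub>m m * b ^\<^sub>m (k - m)) $$ (i, j) / fact k)"
    proof (rule sum.cong[OF refl])
      fix m assume "m \<in> {..k}"
      then have c: "of_nat (k choose m) = (fact k / (fact m * fact (k - m)) :: complex)"
        by (simp add: binomial_fact)
      show "(\<Sum>l<n. ((a ^\<^sub>m m) $$ (i, l) / fact m) * ((b ^\<^sub>m (k - m)) $$ (l, j) / fact (k - m)))
          = of_nat (k choose m) * (a ^\<^sub>m m * b ^\<^sub>m (k - m)) $$ (i, j) / fact k"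
        unfolding c using a b ij
        by (simp add: mult_mat_entry[of _ n n _ n] pow_carrier_mat sum_distrib_left sum_divide_distrib)
    qed
    also have "\<dots> = ordered_binomial n a b k $$ (i, j) / fact k"
      by (simp add: ordered_binomial_entry[OF a b ij] sum_divide_distrib)
    finally show "(\<Sum>l<n. \<Sum>m\<le>k. ((a ^\<^sub>m m) $$ (i, l) / fact m) * ((b ^\<^sub>m (k - m)) $$ (l, j) / fact (k - m)))
        = ordered_binomial n a b k $$ (i, j) / fact k" .
  qed
  finally show ?thesis .
qed

lemma ordered_binomial_upper_triangular:
  assumes a: "a \<in> carrier_mat n n" "upper_triangular a" and b: "b \<in> carrier_mat n n" "upper_triangular b"
  shows "upper_triangular (ordered_binomial n a b k)"
    and "i < n \<Longrightarrow> ordered_binomial n a b k $$ (i, i) = (a $$ (i, i) + b $$ (i, i)) ^ k"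
proof -
  let ?T = "ordered_binomial n a b"
  have "upper_triangular (?T k) \<and> (\<forall>i<n. ?T k $$ (i, i) = (a $$ (i, i) + b $$ (i, i)) ^ k)"
  proof (induction k)
    case (Suc k)
    note T = ordered_binomial_carrier[OF a(1) b(1), of k]
    have ut: "upper_triangular (a * ?T k)" "upper_triangular (?T k * b)"
      using upper_triangular_mult(1)[OF a(1) T a(2)] upper_triangular_mult(1)[OF T b(1) _ b(2)] Suc by auto
    have "upper_triangular (?T (Suc k))"
      using upper_triangularD[OF ut(1)] upper_triangularD[OF ut(2)] a b T by (intro upper_triangularI) auto
    moreover have "?T (Suc k) $$ (i, i) = (a $$ (i, i) + b $$ (i, i)) ^ Suc k" if "i < n" for i
      using upper_triangular_mult(2)[OF a(1) T a(2)] upper_triangular_mult(2)[OF T b(1) _ b(2)] Suc that a b T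
      by (simp add: algebra_simps)
    ultimately show ?case by blast
  qed auto
  then show "upper_triangular (?T k)" "i < n \<Longrightarrow> ?T k $$ (i, i) = (a $$ (i, i) + b $$ (i, i)) ^ k"
    by auto
qed

text \<open>Reordering \<open>(a + b) ^ k\<close> costs one commutator per exchanged pair, and at
  the corner it only picks up the common diagonal entries. The defect there is \<open>v\<close>
  times \<open>k choose 2\<close> times \<open>\<sigma> ^ (k - 2)\<close>, which the exponential
  series sums to \<open>v * exp \<sigma> / 2\<close>.\<close>

lemma corner_mat_exp_add:
  assumes a: "a \<in> carrier_mat n n" "upper_triangular a" and b: "b \<in> carrier_mat n n" "upper_triangular b"
    and c: "corner n i j (b * a - a * b) v"
    and eq: "a $$ (i, i) = a $$ (j, j)" "b $$ (i, i) = b $$ (j, j)"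
  shows "corner n i j (mat_exp (a + b) - mat_exp a * mat_exp b) (v * exp (a $$ (i, i) + b $$ (i, i)) / 2)"
proof -
  define \<sigma> where "\<sigma> = a $$ (i, i) + b $$ (i, i)"
  note ij = cornerD(2,3)[OF c]
  have s: "a + b \<in> carrier_mat n n" "upper_triangular (a + b)"
    using a b upper_triangularD[OF a(2)] upper_triangularD[OF b(2)] by auto
  let ?T = "ordered_binomial n a b"
  have T: "?T k \<in> carrier_mat n n" for k using a b by simp
  \<comment> \<open>\<open>\<gamma>\<close> is the corner entry of the commutator with
    \<open>a\<close>, \<open>\<rho>\<close> that of the reordering defect. Truncated subtraction in
    the exponents is harmless, as the integer factors vanish there.\<close>
  define \<gamma> where "\<gamma> k = v * (of_nat k * \<sigma> ^ (k - 1))" for k :: nat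
  define \<rho> where "\<rho> k = v * (of_nat (k * (k - 1)) / 2 * \<sigma> ^ (k - 2))" for k :: nat
  have \<gamma>: "\<gamma> (Suc k) = a $$ (i, i) * \<gamma> k + \<gamma> k * b $$ (j, j) + \<sigma> ^ k * v" for k
  proof -
    have "\<gamma> (Suc k) = \<sigma> * \<gamma> k + \<sigma> ^ k * v" by (cases k) (simp_all add: \<gamma>_def algebra_simps)
    then show ?thesis using eq by (simp add: \<sigma>_def algebra_simps)
  qed
  have \<rho>: "\<rho> (Suc k) = \<rho> k * \<sigma> + \<gamma> k" for k
  proof -
    consider "k = 0" | "k = 1" | k' where "k = Suc (Suc k')" by (metis One_nat_def not0_implies_Suc)
    then show ?thesis by cases (simp_all add: \<rho>_def \<gamma>_def field_simps)
  qed
  have G: "corner n i j (?T k * a - a * ?T k) (\<gamma> k)" for k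
  proof (induction k)
    case 0
    have "?T 0 * a - a * ?T 0 = 0\<^sub>m n n" using a by auto
    then show ?case using corner_zero[OF ij] by (simp add: \<gamma>_def)
  next
    case (Suc k)
    have "?T (Suc k) * a - a * ?T (Suc k)
      = a * (?T k * a - a * ?T k) + (?T k * a - a * ?T k) * b + ?T k * (b * a - a * b)"
      using commutator_ordered_product[OF a(1) b(1) T] by simp
    moreover have "?T k $$ (i, i) = \<sigma> ^ k"
      using ordered_binomial_upper_triangular(2)[OF a b ij(1)] by (simp add: \<sigma>_def)
    ultimately show ?case
      using corner_add[OF corner_add[OF corner_mult_left[OF a Suc] corner_mult_right[OF b Suc]]
          corner_mult_left[OF T ordered_binomial_upper_triangular(1)[OF a b] c, of k]]
      by (simp only: \<gamma>)
  qed
  have R: "corner n i j ((a + b) ^\<^sub>m k - ?T k) (\<rho> k)" for k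
  proof (induction k)
    case 0
    have "(a + b) ^\<^sub>m 0 - ?T 0 = 0\<^sub>m n n" using a b by auto
    then show ?case using corner_zero[OF ij] by (simp add: \<rho>_def)
  next
    case (Suc k)
    have "(a + b) ^\<^sub>m Suc k - ?T (Suc k) = ((a + b) ^\<^sub>m k - ?T k) * (a + b) + (?T k * a - a * ?T k)"
      using ordered_product_defect[OF a(1) b(1) T pow_carrier_mat[OF s(1)]] by simp
    moreover have "(a + b) $$ (j, j) = \<sigma>" using a b ij eq by (simp add: \<sigma>_def)
    ultimately show ?case
      using corner_add[OF corner_mult_right[OF s Suc] G[of k]] by (simp only: \<rho>)
  qed
  show ?thesis
  proof (rule corner_sums[OF R])
    show "mat_exp (a + b) - mat_exp a * mat_exp b \<in> carrier_mat n n"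
      using a b by (intro minus_carrier_mat mult_carrier_mat[of _ n n]) auto
    show "(\<lambda>k. ((a + b) ^\<^sub>m k - ?T k) $$ (r, l) / fact k) sums
        ((mat_exp (a + b) - mat_exp a * mat_exp b) $$ (r, l))" if "r < n" "l < n" for r l
      using sums_diff[OF mat_exp_sums[OF s(1) that] mat_exp_mult_mat_exp_sums[OF a(1) b(1) that]]
        that a b T by (simp add: diff_divide_distrib)
    have "(\<lambda>k. v / 2 * (\<sigma> ^ k /\<^sub>R fact k)) sums (v / 2 * exp \<sigma>)"
      by (intro sums_mult exp_converges)
    \<comment> \<open>The series is shifted by two, because \<open>\<rho> 0\<close> and
      \<open>\<rho> 1\<close> vanish; the factor \<open>(k + 2) * (k + 1)\<close> cancels against
      the factorial.\<close>
    moreover have "v / 2 * (\<sigma> ^ k /\<^sub>R fact k) = \<rho> (k + 2) / fact (k + 2)" for k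
    proof -
      define N where "N = complex_of_nat ((k + 2) * (k + 2 - 1))"
      have f: "fact (k + 2) = N * fact k" by (simp add: N_def algebra_simps)
      have "N \<noteq> 0" unfolding N_def of_nat_eq_0_iff by simp
      moreover have "\<rho> (k + 2) = v * (N / 2 * \<sigma> ^ k)" by (simp only: \<rho>_def N_def add_diff_cancel_right')
      ultimately show ?thesis unfolding f by (simp add: scaleR_conv_of_real field_simps)
    qed
    ultimately have "(\<lambda>k. \<rho> (k + 2) / fact (k + 2)) sums (v / 2 * exp \<sigma>)" by simp
    then show "(\<lambda>k. \<rho> k / fact k) sums (v * exp (a $$ (i, i) + b $$ (i, i)) / 2)"
      by (subst (asm) sums_iff_shift) (simp add: \<rho>_def \<sigma>_def numeral_2_eq_2)
  qed
qed

lemma upper_triangular_mat_exp_add_commute: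
  assumes a: "a \<in> carrier_mat n n" "upper_triangular a" and b: "b \<in> carrier_mat n n" "upper_triangular b"
    and sa: "\<And>i. i < n \<Longrightarrow> \<bar>Im (a $$ (i, i))\<bar> < pi"
    and sb: "\<And>i. i < n \<Longrightarrow> \<bar>Im (b $$ (i, i))\<bar> < pi"
    and sab: "\<And>i. i < n \<Longrightarrow> \<bar>Im ((a + b) $$ (i, i))\<bar> < pi"
    and exp_add: "mat_exp (a + b) = mat_exp a * mat_exp b"
  shows "b * a = a * b"
proof -
  have ab: "b * a \<in> carrier_mat n n" "a * b \<in> carrier_mat n n" using a b by auto
  let ?x = "mat_exp a" and ?y = "mat_exp b"
  have x: "?x \<in> carrier_mat n n" "upper_triangular ?x" and y: "?y \<in> carrier_mat n n" "upper_triangular ?y"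
    using a b upper_triangular_mat_exp(1) by auto
  have s: "a + b \<in> carrier_mat n n" "upper_triangular (a + b)"
    using a b upper_triangularD[OF a(2)] upper_triangularD[OF b(2)] by auto
  have "b * a - a * b = 0\<^sub>m n n"
  proof (rule ccontr)
    assume "b * a - a * b \<noteq> 0\<^sub>m n n"
    then obtain i j v where v: "v \<noteq> 0" and c: "corner n i j (b * a - a * b) v"
      using exists_corner[of "b * a - a * b" n] ab by (auto simp: minus_carrier_mat)
    have ij: "i < n" "j < n" using cornerD[OF c] by auto
    have "a * b - b * a = 0\<^sub>m n n - (b * a - a * b)"
      using a b by (intro eq_matI) auto
    then have c': "corner n i j (a * b - b * a) (- v)"
      using corner_minus[OF corner_zero[OF ij] c] by simp
    \<comment> \<open>The points \<open>P\<close>, \<open>Q\<close>, \<open>R\<close> are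
      \<open>u + w\<close>, \<open>u + w'\<close> and \<open>u' + w'\<close>.\<close>
    define u u' w w' where "u = a $$ (i, i)" and "u' = a $$ (j, j)" and "w = b $$ (i, i)" and "w' = b $$ (j, j)"
    have sum: "(a + b) $$ (i, i) = u + w" "(a + b) $$ (j, j) = u' + w'"
      using a b ij by (auto simp: u_def u'_def w_def w'_def)
    have xa: "?x * a = a * ?x" and yb: "?y * b = b * ?y"
      using a b by (auto intro: mat_exp_intertwine)
    have "corner n i j (mat_exp (a + b) * a - a * mat_exp (a + b)) (v * exp_dd (u + w) (u' + w'))"
      using corner_mat_exp[OF s s a(1), of i j v] c
      unfolding sum add_commutator[OF a(1) b(1)] by blast
    \<comment> \<open>\<open>?x\<close> commutes with \<open>a\<close>, so only the commutator of
      \<open>?y\<close> with \<open>a\<close> remains; its corner follows from the same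
      \<open>v\<close>.\<close>
    moreover have "mat_exp (a + b) * a - a * mat_exp (a + b) = ?x * (?y * a - a * ?y)"
    proof -
      have "?x * (?y * a - a * ?y) = ?x * ?y * a - ?x * a * ?y"
        using x y a(1) by (simp add: square_mat_simps[where n = n])
      also have "\<dots> = ?x * ?y * a - a * (?x * ?y)"
        unfolding xa using x y a(1) by (simp add: square_mat_simps[where n = n])
      finally show ?thesis by (simp add: exp_add)
    qed
    ultimately have "v * exp_dd (u + w) (u' + w') = exp u * (v * exp_dd w w')"
      using corner_mult_left[OF x corner_mat_exp[OF b b a(1) c]] upper_triangular_mat_exp(2)[OF a ij(1)] cornerD(4)
      unfolding u_def w_def w'_def by metis
    then have E1: "exp_dd (u + w) (u' + w') = exp_dd (u + w) (u + w')"
      using v by (simp add: exp_dd_add)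
    have "corner n i j (mat_exp (a + b) * b - b * mat_exp (a + b)) (- v * exp_dd (u + w) (u' + w'))"
      using corner_mat_exp[OF s s b(1), of i j "- v"] c'
      unfolding sum add_commutator[OF a(1) b(1)] by blast
    moreover have "mat_exp (a + b) * b - b * mat_exp (a + b) = (?x * b - b * ?x) * ?y"
    proof -
      have "(?x * b - b * ?x) * ?y = ?x * (b * ?y) - b * (?x * ?y)"
        using x y b(1) by (simp add: square_mat_simps[where n = n])
      also have "\<dots> = ?x * ?y * b - b * (?x * ?y)"
        unfolding yb[symmetric] using x y b(1) by (simp add: square_mat_simps[where n = n])
      finally show ?thesis by (simp add: exp_add)
    qed
    ultimately have "- v * exp_dd (u + w) (u' + w') = - v * exp_dd u u' * exp w'"
      using corner_mult_right[OF y corner_mat_exp[OF a a b(1) c']] upper_triangular_mat_exp(2)[OF b ij(2)] cornerD(4)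
      unfolding u_def u'_def w'_def by metis
    then have E2: "exp_dd (u + w) (u' + w') = exp_dd (u + w') (u' + w')"
      using v exp_dd_add[of w' u u'] by (simp add: algebra_simps)
    \<comment> \<open>The strips for \<open>b\<close>, \<open>a\<close> and \<open>a + b\<close>
      bound the imaginary parts of \<open>P - Q\<close>, \<open>Q - R\<close> and
      \<open>P - R\<close> respectively.\<close>
    have "u + w = u + w' \<and> u + w' = u' + w'"
    proof (rule exp_dd_three_points)
      show "\<bar>Im (u + w - (u + w'))\<bar> < 2 * pi" using sb[OF ij(1)] sb[OF ij(2)] by (auto simp: w_def w'_def)
      show "\<bar>Im (u + w' - (u' + w'))\<bar> < 2 * pi" using sa[OF ij(1)] sa[OF ij(2)] by (auto simp: u_def u'_def)
      show "\<bar>Im (u + w - (u' + w'))\<bar> < 2 * pi"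
        using sab[OF ij(1)] sab[OF ij(2)] unfolding sum minus_complex.sel by linarith
    qed (use E1 E2 in simp_all)
    then have "a $$ (i, i) = a $$ (j, j)" "b $$ (i, i) = b $$ (j, j)"
      by (auto simp: u_def u'_def w_def w'_def)
    from cornerD(4)[OF corner_mat_exp_add[OF a b c this]]
    have "v * exp (a $$ (i, i) + b $$ (i, i)) / 2 = 0"
      unfolding exp_add using a(1) b(1) ij by simp
    then show False using v by simp
  qed
  show ?thesis
  proof (rule eq_matI)
    fix i j assume ij: "i < dim_row (a * b)" "j < dim_col (a * b)"
    then have "i < n" "j < n" using a b by auto
    then have "(b * a - a * b) $$ (i, j) = 0" by (simp add: \<open>b * a - a * b = 0\<^sub>m n n\<close>)
    then show "(b * a) $$ (i, j) = (a * b) $$ (i, j)" using ij ab by simp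
  qed (use a b in auto)
qed

theorem theorem2:
  fixes n :: nat and x y :: "complex mat"
  assumes "x \<in> carrier_mat n n" and "y \<in> carrier_mat n n"
    and "\<forall>z \<in> \<real>\<^sub>\<le>\<^sub>0. \<not> eigenvalue x z"
    and "\<forall>z \<in> \<real>\<^sub>\<le>\<^sub>0. \<not> eigenvalue y z"
    and "\<forall>z \<in> \<real>\<^sub>\<le>\<^sub>0. \<not> eigenvalue (x * y) z"
    and "mat_log (x * y) = mat_log x + mat_log y"
    and "simultaneously_triangularizable n x y"
  shows "x * y = y * x"
proof -
  note x = assms(1) and y = assms(2)
  obtain p q where p: "p \<in> carrier_mat n n" and q: "q \<in> carrier_mat n n"
    and inv: "inverts_mat p q" "inverts_mat q p"
    and tri: "upper_triangular (q * x * p)" "upper_triangular (q * y * p)"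
    using assms(7) unfolding simultaneously_triangularizable_def by blast
  have pq: "p * q = 1\<^sub>m n" "q * p = 1\<^sub>m n" using inv p q by (auto simp: inverts_mat_def)
  have sim: "similar_mat_wit z (q * z * p) p q" if z: "z \<in> carrier_mat n n" for z
  proof -
    have "p * (q * z * p) * q = (p * q) * z * (p * q)"
      using z p q by (simp add: square_mat_simps[where n = n])
    then have "z = p * (q * z * p) * q" using z pq by simp
    then show ?thesis using z p q pq by (intro similar_mat_witI[of _ _ n]) auto
  qed
  let ?X = "q * x * p" and ?Y = "q * y * p"
  have X: "?X \<in> carrier_mat n n" and Y: "?Y \<in> carrier_mat n n" using x y p q by auto
  have XY: "q * (u * v) * p = (q * u * p) * (q * v * p)"
    if u: "u \<in> carrier_mat n n" and v: "v \<in> carrier_mat n n" for u v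
  proof -
    have "(q * u * p) * (q * v * p) = q * u * (p * q) * (v * p)"
      using u v p q by (simp add: square_mat_simps[where n = n])
    also have "\<dots> = q * u * (v * p)" unfolding pq(1) using u q right_mult_one_mat[of "q * u" n n] by simp
    finally show ?thesis using u v p q by (simp add: square_mat_simps[where n = n])
  qed
  have xy: "x * y \<in> carrier_mat n n" using x y by simp
  have "upper_triangular (q * (x * y) * p)"
    unfolding XY[OF x y] using upper_triangular_mult(1)[OF X Y] tri by blast
  \<comment> \<open>The same \<open>p\<close> and \<open>q\<close> serve for all three logarithms,
    so their triangular forms can be added and compared.\<close>
  then obtain s where s: "similar_mat_wit (mat_log (x * y)) s p q" "mat_exp s = ?X * ?Y"
      "\<And>i. i < n \<Longrightarrow> \<bar>Im (s $$ (i, i))\<bar> < pi"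
    using mat_log_triangularizable[OF xy sim[OF xy] _ assms(5)] unfolding XY[OF x y] by blast
  obtain a where a: "similar_mat_wit (mat_log x) a p q" "upper_triangular a" "mat_exp a = ?X"
      "\<And>i. i < n \<Longrightarrow> \<bar>Im (a $$ (i, i))\<bar> < pi"
    using mat_log_triangularizable[OF x sim[OF x] tri(1) assms(3)] by blast
  obtain b where b: "similar_mat_wit (mat_log y) b p q" "upper_triangular b" "mat_exp b = ?Y"
      "\<And>i. i < n \<Longrightarrow> \<bar>Im (b $$ (i, i))\<bar> < pi"
    using mat_log_triangularizable[OF y sim[OF y] tri(2) assms(4)] by blast
  have wit: "c \<in> carrier_mat n n \<and> l \<in> carrier_mat n n \<and> c = q * l * p" if "similar_mat_wit l c p q" for l c
  proof -
    note w = similar_mat_witD[OF refl similar_mat_wit_sym[OF that]]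
    have "dim_row c = n" using w(6) q by auto
    then show ?thesis using w(3-5) by blast
  qed
  note ac = wit[OF a(1)] and bc = wit[OF b(1)] and sc = wit[OF s(1)]
  \<comment> \<open>Additivity of the logarithms is carried over to the triangular forms by the
    linearity of conjugation.\<close>
  have "s = q * (mat_log x + mat_log y) * p" using sc assms(6) by metis
  also have "\<dots> = q * mat_log x * p + q * mat_log y * p"
  proof -
    have "mat_log x \<in> carrier_mat n n" "mat_log y \<in> carrier_mat n n" using ac bc by blast+
    then show ?thesis using p q by (simp add: square_mat_simps[where n = n])
  qed
  also have "\<dots> = a + b" using ac bc by metis
  finally have s_eq: "s = a + b" .
  have ca: "a \<in> carrier_mat n n" and cb: "b \<in> carrier_mat n n" using ac bc by blast+
  have "b * a = a * b"
  proof (rule upper_triangular_mat_exp_add_commute[OF ca a(2) cb b(2) a(4) b(4)])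
    show "mat_exp (a + b) = mat_exp a * mat_exp b" using s(2) unfolding s_eq a(3) b(3) .
    show "\<bar>Im ((a + b) $$ (i, i))\<bar> < pi" if "i < n" for i using s(3)[OF that] unfolding s_eq .
  qed
  \<comment> \<open>Commutation passes from the logarithms to the exponentials one factor at a
    time.\<close>
  then have "mat_exp b * a = a * mat_exp b" by (rule mat_exp_intertwine[OF cb cb ca])
  then have "mat_exp a * mat_exp b = mat_exp b * mat_exp a"
    by (intro mat_exp_intertwine[OF ca ca]) (use cb in simp_all)
  then have "q * (x * y) * p = q * (y * x) * p" unfolding a(3) b(3) XY[OF x y] XY[OF y x] .
  then have "p * (q * (x * y) * p) * q = p * (q * (y * x) * p) * q" by simp
  moreover have "p * (q * z * p) * q = z" if "z \<in> carrier_mat n n" for z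
    using similar_mat_witD(3)[OF refl sim[OF that]] by simp
  moreover have "y * x \<in> carrier_mat n n" using x y by simp
  ultimately show ?thesis using xy by metis
qed

end
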